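(* Let $K\subset\mathbb{R}^3$ be a generic knot. Over $\overline{S_K}$ (i.e. restricted to the points $(s_1,\theta_1,s_2,\theta_2)$ with $(s_1,s_2)\in\overline{S_K}$) the manifold $M_{K,0}$ is diffeomorphic to $\overline{S_K}\times[-\pi/2,\pi/2]\times[-\pi/2,\pi/2]$.
   Context: $K\subset\mathbb{R}^3$ is a smooth knot of length $T$ with arc-length parametrization $\gamma:\mathbb{R}/T\mathbb{Z}\to\mathbb{R}^3$; $n=\ddot\gamma/\|\ddot\gamma\|$, $b=\dot\gamma\times n$, $v(s,\theta)=\cos(\theta)n(s)+\sin(\theta)b(s)$. For $i=1,2$, $F_i^{[0]}(s_1,\theta_1,s_2,\theta_2)=\langle\gamma(s_2)-\gamma(s_1),v(s_i,\theta_i)\rangle$, and $M_{K,0}=\overline{\{F_1^{[0]}\ge0,\ F_2^{[0]}\ge0,\ s_1\neq s_2\}}\subset(\mathbb{R}/T\mathbb{Z}\times S^1)^2$. Over $\overline{S_K}$, $M_{K,0}$ is a compact $4$-manifold with corners. A pair $(s_1,s_2)$, $s_1\neq s_2$, is special if the tangent line of $K$ at one of $\gamma(s_1),\gamma(s_2)$ passes through the other point. $K$ is generic if its curvature vanishes nowhere, there are finitely many special pairs, for a special pair with tangent line at $\gamma(s_i)$ passing through $\gamma(s_j)$ the tangent line at $\gamma(s_j)$ is not contained in the osculating plane at $\gamma(s_i)$, and no two distinct points of $K$ have the same tangent line. Fix a sufficiently small $\delta_K>0$ such that the weakly diagonal set $\{\widetilde d(s_1,s_2)\le\delta_K\}$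 ($\widetilde d$ the flat distance on $\mathbb{R}/T\mathbb{Z}$) and the weakly special sets (closed squares of half-side $\delta_K$ centered at special pairs) are pairwise disjoint. The standard set $S_K\subset(\mathbb{R}/T\mathbb{Z})^2$ is the complement of the union of the weakly diagonal set and the weakly special sets. *)

theory Defs
  imports "HOL-Analysis.Analysis"
begin

text \<open>\<open>C_on n f U\<close>: all iterated directional derivatives of \<open>f\<close> of order at most \<open>n\<close> exist
  and are continuous. It is only meant for open \<open>U\<close>.\<close>

primrec C_on :: "nat \<Rightarrow> ('a::real_normed_vector \<Rightarrow> 'b::real_normed_vector) \<Rightarrow> 'a set \<Rightarrow> bool" where
  "C_on 0 f U \<longleftrightarrow> continuous_on U f"
| "C_on (Suc n) f U \<longleftrightarrow>
     (\<forall>x\<in>U. f differentiable (at x)) \<and> (\<forall>v. C_on n (\<lambda>x. frechet_derivative f (at x) v) U)"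

definition smooth_on :: "'a::real_normed_vector set \<Rightarrow> ('a \<Rightarrow> 'b::real_normed_vector) \<Rightarrow> bool" where
  "smooth_on U f \<longleftrightarrow> (\<forall>n. C_on n f U)"

text \<open>
  The ambient manifolds are quotients of a Euclidean space by a discrete group of translations,
  and are given with their covering projections \<open>p :: 'a \<Rightarrow> 'x\<close> and \<open>q :: 'b \<Rightarrow> 'y\<close>, which are
  local diffeomorphisms. As usual, a map on an arbitrary subset \<open>A\<close> of a manifold is smooth if
  near each point of \<open>A\<close> it extends to a smooth map on an open set; the extension is expressed
  here in the local coordinates provided by \<open>p\<close> and \<open>q\<close>. This covers manifolds with corners
  and other closed domains of full dimension.
\<close>

definition smooth_map ::
  "('a::euclidean_space \<Rightarrow> 'x) \<Rightarrow> ('b::euclidean_space \<Rightarrow> 'y) \<Rightarrow> 'x set \<Rightarrow> ('x \<Rightarrow> 'y) \<Rightarrow> bool" where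
  "smooth_map p q A f \<longleftrightarrow>
     (\<forall>x. p x \<in> A \<longrightarrow>
        (\<exists>U g. open U \<and> x \<in> U \<and> smooth_on U g \<and> (\<forall>y\<in>U. p y \<in> A \<longrightarrow> q (g y) = f (p y))))"

definition diffeomorphic ::
  "('a::euclidean_space \<Rightarrow> 'x) \<Rightarrow> ('b::euclidean_space \<Rightarrow> 'y) \<Rightarrow> 'x set \<Rightarrow> 'y set \<Rightarrow> bool" where
  "diffeomorphic p q A B \<longleftrightarrow>
     (\<exists>f g. f ` A \<subseteq> B \<and> g ` B \<subseteq> A \<and> (\<forall>x\<in>A. g (f x) = x) \<and> (\<forall>y\<in>B. f (g y) = y) \<and>
            smooth_map p q A f \<and> smooth_map q p B g)"

definition period_rel :: "real \<Rightarrow> (real \<times> real) set" where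
  "period_rel T = {(x, y). \<exists>k::int. y - x = of_int k * T}"

definition circle :: "real \<Rightarrow> real set set" where
  "circle T = UNIV // period_rel T"

definition proj :: "real \<Rightarrow> real \<Rightarrow> real set" where
  "proj T x = period_rel T `` {x}"

definition circle_topology :: "real \<Rightarrow> real set topology" where
  "circle_topology T = topology (\<lambda>U. U \<subseteq> circle T \<and> open {x. proj T x \<in> U})"

lemma circle_eq: "circle T = range (proj T)"
  by (auto simp: circle_def proj_def quotient_def)

lemma openin_circle: "openin (circle_topology T) U \<longleftrightarrow> U \<subseteq> circle T \<and> open {x. proj T x \<in> U}"
proof -
  have "istopology (\<lambda>U. U \<subseteq> circle T \<and> open {x. proj T x \<in> U})"
    unfolding istopology_def
  proof (intro conjI allI impI)
    fix S S' assume "S \<subseteq> circle T \<and> open {x. proj T x \<in> S}" "S' \<subseteq> circle T \<and> open {x. proj T x \<in> S'}"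
    then show "S \<inter> S' \<subseteq> circle T" "open {x. proj T x \<in> S \<inter> S'}"
      by (auto simp: open_Collect_conj)
  next
    fix \<K> assume K: "\<forall>S\<in>\<K>. S \<subseteq> circle T \<and> open {x. proj T x \<in> S}"
    then show "\<Union>\<K> \<subseteq> circle T" by auto
    have "{x. proj T x \<in> \<Union>\<K>} = (\<Union>S\<in>\<K>. {x. proj T x \<in> S})" by auto
    with K show "open {x. proj T x \<in> \<Union>\<K>}" by auto
  qed
  then show ?thesis by (simp add: circle_topology_def)
qed

lemma topspace_circle: "topspace (circle_topology T) = circle T"
proof -
  have "openin (circle_topology T) (circle T)"
    by (simp add: openin_circle circle_eq)
  then show ?thesis
    by (metis openin_circle openin_subset openin_topspace subset_antisym)
qed

lemma quotient_map_proj: "quotient_map euclidean (circle_topology T) (proj T)"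
  by (auto simp: quotient_map_def topspace_circle openin_circle circle_eq)

lemma proj_eq_iff: "proj T x = proj T y \<longleftrightarrow> (\<exists>k::int. y - x = of_int k * T)"
proof
  assume "proj T x = proj T y"
  moreover have "y \<in> proj T y"
    by (auto simp: proj_def period_rel_def intro: exI[of _ "0::int"])
  ultimately show "\<exists>k::int. y - x = of_int k * T"
    by (auto simp: proj_def period_rel_def)
next
  assume "\<exists>k::int. y - x = of_int k * T"
  then obtain k :: int where k: "y = x + of_int k * T" by (auto simp: algebra_simps)
  have "z - x = of_int m * T \<longleftrightarrow> z - y = of_int (m - k) * T" for z and m :: int
    by (auto simp: k algebra_simps)
  moreover have "z - y = of_int m * T \<longleftrightarrow> z - x = of_int (m + k) * T" for z and m :: int
    by (auto simp: k algebra_simps)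
  ultimately show "proj T x = proj T y"
    unfolding proj_def period_rel_def by blast
qed

text \<open>The flat distance: the infimum of \<open>\<bar>x - y\<bar>\<close> over all representatives.\<close>

definition flat_dist :: "real set \<Rightarrow> real set \<Rightarrow> real" where
  "flat_dist P Q = setdist P Q"

text \<open>A knot is given by its arc-length parametrization, lifted to a \<open>T\<close>-periodic map on the line.\<close>

definition knot :: "real \<Rightarrow> (real \<Rightarrow> real^3) \<Rightarrow> bool" where
  "knot T \<gamma> \<longleftrightarrow> T > 0 \<and> smooth_on UNIV \<gamma> \<and> (\<forall>s. \<gamma> (s + T) = \<gamma> s) \<and> inj_on \<gamma> {0..<T} \<and>
     (\<forall>s. norm (vector_derivative \<gamma> (at s)) = 1)"

definition velocity :: "(real \<Rightarrow> real^3) \<Rightarrow> real \<Rightarrow> real^3" where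
  "velocity \<gamma> s = vector_derivative \<gamma> (at s)"

definition acceleration :: "(real \<Rightarrow> real^3) \<Rightarrow> real \<Rightarrow> real^3" where
  "acceleration \<gamma> s = vector_derivative (velocity \<gamma>) (at s)"

definition normal :: "(real \<Rightarrow> real^3) \<Rightarrow> real \<Rightarrow> real^3" where
  "normal \<gamma> s = acceleration \<gamma> s /\<^sub>R norm (acceleration \<gamma> s)"

definition binormal :: "(real \<Rightarrow> real^3) \<Rightarrow> real \<Rightarrow> real^3" where
  "binormal \<gamma> s = cross3 (velocity \<gamma> s) (normal \<gamma> s)"

definition normal_vector :: "(real \<Rightarrow> real^3) \<Rightarrow> real \<Rightarrow> real \<Rightarrow> real^3" where
  "normal_vector \<gamma> s \<theta> = cos \<theta> *\<^sub>R normal \<gamma> s + sin \<theta> *\<^sub>R binormal \<gamma> s"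

definition tangent_line :: "(real \<Rightarrow> real^3) \<Rightarrow> real \<Rightarrow> (real^3) set" where
  "tangent_line \<gamma> s = {\<gamma> s + t *\<^sub>R velocity \<gamma> s | t. True}"

definition osculating_plane :: "(real \<Rightarrow> real^3) \<Rightarrow> real \<Rightarrow> (real^3) set" where
  "osculating_plane \<gamma> s = {\<gamma> s + a *\<^sub>R velocity \<gamma> s + b *\<^sub>R acceleration \<gamma> s | a b. True}"

definition special_pairs :: "real \<Rightarrow> (real \<Rightarrow> real^3) \<Rightarrow> (real set \<times> real set) set" where
  "special_pairs T \<gamma> =
     {(proj T s\<^sub>1, proj T s\<^sub>2) | s\<^sub>1 s\<^sub>2.
        proj T s\<^sub>1 \<noteq> proj T s\<^sub>2 \<and> (\<gamma> s\<^sub>2 \<in> tangent_line \<gamma> s\<^sub>1 \<or> \<gamma> s\<^sub>1 \<in> tangent_line \<gamma> s\<^sub>2)}"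

text \<open>The curvature at \<open>s\<close> is \<open>norm (acceleration \<gamma> s)\<close>, since \<open>\<gamma>\<close> has unit speed.\<close>

definition generic_knot :: "real \<Rightarrow> (real \<Rightarrow> real^3) \<Rightarrow> bool" where
  "generic_knot T \<gamma> \<longleftrightarrow> knot T \<gamma> \<and>
     (\<forall>s. norm (acceleration \<gamma> s) \<noteq> 0) \<and>
     finite (special_pairs T \<gamma>) \<and>
     (\<forall>s\<^sub>i s\<^sub>j. proj T s\<^sub>i \<noteq> proj T s\<^sub>j \<and> \<gamma> s\<^sub>j \<in> tangent_line \<gamma> s\<^sub>i \<longrightarrow>
        \<not> tangent_line \<gamma> s\<^sub>j \<subseteq> osculating_plane \<gamma> s\<^sub>i) \<and>
     (\<forall>s\<^sub>1 s\<^sub>2. proj T s\<^sub>1 \<noteq> proj T s\<^sub>2 \<longrightarrow> tangent_line \<gamma> s\<^sub>1 \<noteq> tangent_line \<gamma> s\<^sub>2)"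

definition weakly_diagonal :: "real \<Rightarrow> real \<Rightarrow> (real set \<times> real set) set" where
  "weakly_diagonal T \<delta> = {(P, Q) \<in> circle T \<times> circle T. flat_dist P Q \<le> \<delta>}"

definition weakly_special :: "real \<Rightarrow> real \<Rightarrow> real set \<times> real set \<Rightarrow> (real set \<times> real set) set" where
  "weakly_special T \<delta> c =
     {(P, Q) \<in> circle T \<times> circle T. flat_dist P (fst c) \<le> \<delta> \<and> flat_dist Q (snd c) \<le> \<delta>}"

definition admissible :: "real \<Rightarrow> (real \<Rightarrow> real^3) \<Rightarrow> real \<Rightarrow> bool" where
  "admissible T \<gamma> \<delta> \<longleftrightarrow> \<delta> > 0 \<and>
     (\<forall>c\<in>special_pairs T \<gamma>. weakly_diagonal T \<delta> \<inter> weakly_special T \<delta> c = {}) \<and>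
     disjoint_family_on (weakly_special T \<delta>) (special_pairs T \<gamma>)"

definition standard_set :: "real \<Rightarrow> (real \<Rightarrow> real^3) \<Rightarrow> real \<Rightarrow> (real set \<times> real set) set" where
  "standard_set T \<gamma> \<delta> =
     circle T \<times> circle T - (weakly_diagonal T \<delta> \<union> (\<Union>c\<in>special_pairs T \<gamma>. weakly_special T \<delta> c))"

definition closed_standard_set :: "real \<Rightarrow> (real \<Rightarrow> real^3) \<Rightarrow> real \<Rightarrow> (real set \<times> real set) set" where
  "closed_standard_set T \<gamma> \<delta> =
     prod_topology (circle_topology T) (circle_topology T) closure_of standard_set T \<gamma> \<delta>"

text \<open>Points of \<open>(\<real>/T\<int> \<times> S\<^sup>1)\<^sup>2\<close> are written \<open>((P\<^sub>1, \<Theta>\<^sub>1), (P\<^sub>2, \<Theta>\<^sub>2))\<close>, with \<open>S\<^sup>1 = \<real>/2\<pi>\<int>\<close>.\<close>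

definition F1 :: "(real \<Rightarrow> real^3) \<Rightarrow> real \<Rightarrow> real \<Rightarrow> real \<Rightarrow> real \<Rightarrow> real" where
  "F1 \<gamma> s\<^sub>1 \<theta>\<^sub>1 s\<^sub>2 \<theta>\<^sub>2 = (\<gamma> s\<^sub>2 - \<gamma> s\<^sub>1) \<bullet> normal_vector \<gamma> s\<^sub>1 \<theta>\<^sub>1"

definition F2 :: "(real \<Rightarrow> real^3) \<Rightarrow> real \<Rightarrow> real \<Rightarrow> real \<Rightarrow> real \<Rightarrow> real" where
  "F2 \<gamma> s\<^sub>1 \<theta>\<^sub>1 s\<^sub>2 \<theta>\<^sub>2 = (\<gamma> s\<^sub>2 - \<gamma> s\<^sub>1) \<bullet> normal_vector \<gamma> s\<^sub>2 \<theta>\<^sub>2"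

definition torus4_topology :: "real \<Rightarrow> ((real set \<times> real set) \<times> (real set \<times> real set)) topology" where
  "torus4_topology T =
     prod_topology (prod_topology (circle_topology T) (circle_topology (2 * pi)))
                   (prod_topology (circle_topology T) (circle_topology (2 * pi)))"

definition M0 :: "real \<Rightarrow> (real \<Rightarrow> real^3) \<Rightarrow> ((real set \<times> real set) \<times> (real set \<times> real set)) set" where
  "M0 T \<gamma> = torus4_topology T closure_of
     {((proj T s\<^sub>1, proj (2 * pi) \<theta>\<^sub>1), (proj T s\<^sub>2, proj (2 * pi) \<theta>\<^sub>2)) | s\<^sub>1 \<theta>\<^sub>1 s\<^sub>2 \<theta>\<^sub>2.
        F1 \<gamma> s\<^sub>1 \<theta>\<^sub>1 s\<^sub>2 \<theta>\<^sub>2 \<ge> 0 \<and> F2 \<gamma> s\<^sub>1 \<theta>\<^sub>1 s\<^sub>2 \<theta>\<^sub>2 \<ge> 0 \<and> proj T s\<^sub>1 \<noteq> proj T s\<^sub>2}"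

definition M0_over ::
  "real \<Rightarrow> (real \<Rightarrow> real^3) \<Rightarrow> (real set \<times> real set) set \<Rightarrow>
     ((real set \<times> real set) \<times> (real set \<times> real set)) set" where
  "M0_over T \<gamma> S = {((P\<^sub>1, \<Theta>\<^sub>1), (P\<^sub>2, \<Theta>\<^sub>2)) \<in> M0 T \<gamma>. (P\<^sub>1, P\<^sub>2) \<in> S}"

text \<open>The covering projections of \<open>(\<real>/T\<int> \<times> S\<^sup>1)\<^sup>2\<close> and of \<open>(\<real>/T\<int>)\<^sup>2 \<times> \<real> \<times> \<real>\<close>.\<close>

definition proj_torus4 ::
  "real \<Rightarrow> (real \<times> real) \<times> (real \<times> real) \<Rightarrow> (real set \<times> real set) \<times> (real set \<times> real set)" where
  "proj_torus4 T = map_prod (map_prod (proj T) (proj (2 * pi))) (map_prod (proj T) (proj (2 * pi)))"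

definition proj_torus2 ::
  "real \<Rightarrow> (real \<times> real) \<times> (real \<times> real) \<Rightarrow> (real set \<times> real set) \<times> (real \<times> real)" where
  "proj_torus2 T = map_prod (map_prod (proj T) (proj T)) id"

end

theory Submission
  imports Defs
begin

text \<open>
  Over a pair \<open>(s\<^sub>1, s\<^sub>2)\<close> that is neither diagonal nor special, the chord \<open>w = \<gamma> s\<^sub>2 - \<gamma> s\<^sub>1\<close> is not
  tangent to the knot at either end, so for \<open>i = 1, 2\<close> its projection to the normal plane at \<open>s\<^sub>i\<close>
  is a nonzero vector (\<open>chord_not_tangent\<close>). If \<open>r\<^sub>i\<close> is the length and \<open>\<phi>\<^sub>i\<close> the argument of this
  vector in the frame (normal, binormal), then \<open>F\<^sub>i = r\<^sub>i cos (\<theta>\<^sub>i - \<phi>\<^sub>i)\<close>. So the fibre of \<open>M\<^sub>K\<^sub>,\<^sub>0\<close> over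
  \<open>(s\<^sub>1, s\<^sub>2)\<close> is the product of the two half circles \<open>\<bar>\<theta>\<^sub>i - \<phi>\<^sub>i\<bar> \<le> \<pi>/2\<close>, and the diffeomorphism sends
  \<open>\<theta>\<^sub>i\<close> to \<open>\<theta>\<^sub>i - \<phi>\<^sub>i\<close>. The closed standard set stays away from the diagonal and from the special
  pairs, because each of these lies in the interior of one of the removed sets; and off the diagonal
  the closure in the definition of \<open>M\<^sub>K\<^sub>,\<^sub>0\<close> adds no points, since the \<open>F\<^sub>i\<close> are continuous
  (\<open>proj_torus4_mem_M0_iff\<close>).

  The argument \<open>\<phi>\<^sub>i\<close> is only defined modulo \<open>2\<pi>\<close>. The proof works with the difference
  \<open>t = \<theta> - \<phi>\<close> instead, which on the whole open region \<open>t \<in> (-\<pi>, \<pi>)\<close> is given by the half-angle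
  formula \<open>t = 2 arctan (sin t / (1 + cos t))\<close>. In terms of the coordinates \<open>(a, b)\<close> of the projected chord
  this reads
  \<open>2 arctan ((a sin \<theta> - b cos \<theta>) / (\<surd>(a\<^sup>2 + b\<^sup>2) + a cos \<theta> + b sin \<theta>))\<close>,
  a smooth and manifestly periodic function of \<open>(s\<^sub>1, s\<^sub>2, \<theta>)\<close> wherever the denominator is
  positive, and this region contains the closed half circle. The same function yields a local inverse:
  starting from an arbitrary angle \<open>\<theta>\<^sub>0\<close> in the region, subtracting its offset lands on a local smooth
  branch of \<open>\<phi>\<close>, so \<open>(s\<^sub>1, s\<^sub>2, t) \<mapsto> \<theta>\<^sub>0 - offset (\<theta>\<^sub>0) + t\<close> lifts the inverse map
  (\<open>angle_offset_prescribed\<close>).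
\<close>

section \<open>Calculus of maps of class \<open>C\<^sup>n\<close> on open sets\<close>

lemma C_on_subset: "C_on n f U \<Longrightarrow> V \<subseteq> U \<Longrightarrow> C_on n f V"
  by (induction n arbitrary: f) (auto intro: continuous_on_subset)

text \<open>Needed because a derivative is known by a formula only at the points of the open set, whereas
  \<^const>\<open>C_on\<close> iterates a derivative defined everywhere.\<close>

lemma C_on_cong:
  assumes "open U" "\<And>x. x \<in> U \<Longrightarrow> f x = g x"
  shows "C_on n f U \<longleftrightarrow> C_on n g U"
  using assms(2)
proof (induction n arbitrary: f g)
  case 0
  then show ?case by (simp cong: continuous_on_cong)
next
  case (Suc n)
  have D: "(f has_derivative D) (at x) \<longleftrightarrow> (g has_derivative D) (at x)" if "x \<in> U" for x D
    using Suc.prems assms(1) that by (metis has_derivative_transform_within_open)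
  then have "C_on n (\<lambda>x. frechet_derivative f (at x) v) U \<longleftrightarrow>
      C_on n (\<lambda>x. frechet_derivative g (at x) v) U" for v
    by (intro Suc.IH) (simp add: frechet_derivative_def)
  moreover have "f differentiable (at x) \<longleftrightarrow> g differentiable (at x)" if "x \<in> U" for x
    using D[OF that] by (simp add: differentiable_def)
  ultimately show ?case by simp
qed

text \<open>Raising the order by one from an explicit formula for the derivative, so that the choice
  operator in \<^const>\<open>frechet_derivative\<close> need not be met again.\<close>

lemma C_on_SucI:
  assumes "open U" "\<And>x. x \<in> U \<Longrightarrow> (f has_derivative D x) (at x)"
    and "\<And>v. C_on n (\<lambda>x. D x v) U"
  shows "C_on (Suc n) f U"
proof -
  have "frechet_derivative f (at x) = D x" if "x \<in> U" for x
    using assms(2)[OF that] by (metis frechet_derivative_at)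
  then have "C_on n (\<lambda>x. frechet_derivative f (at x) v) U" for v
    using C_on_cong[OF assms(1), of "\<lambda>x. frechet_derivative f (at x) v" "\<lambda>x. D x v"] assms(3)
    by simp
  then show ?thesis
    using assms(2) by (auto simp: differentiable_def)
qed

lemma C_on_SucD:
  assumes "C_on (Suc n) f U"
  shows "x \<in> U \<Longrightarrow> (f has_derivative frechet_derivative f (at x)) (at x)"
    and "C_on n (\<lambda>x. frechet_derivative f (at x) v) U"
  using assms by (auto simp: frechet_derivative_works)

lemma C_on_lower: "C_on (Suc n) f U \<Longrightarrow> C_on n f U"
proof (induction n arbitrary: f)
  case 0
  then have "continuous (at x) f" if "x \<in> U" for x
    using that differentiable_imp_continuous_within by (metis C_on.simps(2))
  then show ?case
    by (simp add: continuous_at_imp_continuous_on)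
next
  case (Suc n)
  have "C_on n (\<lambda>x. frechet_derivative f (at x) v) U" for v
    by (rule Suc.IH) (use Suc.prems C_on.simps(2)[of "Suc n" f U] in blast)
  with Suc.prems show ?case
    using C_on.simps(2)[of n f U] C_on.simps(2)[of "Suc n" f U] by blast
qed

lemma C_on_const: "open U \<Longrightarrow> C_on n (\<lambda>x. c) U"
  by (induction n arbitrary: c) (auto intro!: C_on_SucI derivative_eq_intros simp del: C_on.simps(2))

lemma C_on_bounded_linear:
  assumes "bounded_linear L" "open U"
  shows "C_on n f U \<Longrightarrow> C_on n (\<lambda>x. L (f x)) U"
proof (induction n arbitrary: f)
  case 0
  then show ?case using assms(1) by (auto intro: bounded_linear.continuous_on)
next
  case (Suc n)
  show ?case
    by (rule C_on_SucI[OF assms(2) bounded_linear.has_derivative[OF assms(1) C_on_SucD(1)[OF Suc.prems]]])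
       (use Suc.IH C_on_SucD(2)[OF Suc.prems] in auto)
qed

lemma C_on_id: "open U \<Longrightarrow> C_on n (\<lambda>x. x) U"
  by (cases n) (auto intro!: C_on_SucI C_on_const derivative_eq_intros continuous_on_id
                     simp del: C_on.simps(2))

lemma C_on_add:
  assumes "open U"
  shows "C_on n f U \<Longrightarrow> C_on n g U \<Longrightarrow> C_on n (\<lambda>x. f x + g x) U"
proof (induction n arbitrary: f g)
  case 0
  then show ?case by (auto intro: continuous_intros)
next
  case (Suc n)
  show ?case
    by (rule C_on_SucI[OF assms
          has_derivative_add[OF C_on_SucD(1)[OF Suc.prems(1)] C_on_SucD(1)[OF Suc.prems(2)]]])
       (use Suc.IH C_on_SucD(2)[OF Suc.prems(1)] C_on_SucD(2)[OF Suc.prems(2)] in auto)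
qed

text \<open>By the product rule, the derivative of \<open>B f g\<close> is a sum of terms of the same shape, in which one
  factor is differentiated and the other is kept; the kept one loses an order by \<open>C_on_lower\<close>.\<close>

lemma C_on_bounded_bilinear:
  assumes "bounded_bilinear B" "open U"
  shows "C_on n f U \<Longrightarrow> C_on n g U \<Longrightarrow> C_on n (\<lambda>x. B (f x) (g x)) U"
proof (induction n arbitrary: f g)
  case 0
  then show ?case using assms(1) by (auto intro: bounded_bilinear.continuous_on)
next
  case (Suc n)
  show ?case
    by (rule C_on_SucI[OF assms(2) bounded_bilinear.FDERIV[OF assms(1)
            C_on_SucD(1)[OF Suc.prems(1)] C_on_SucD(1)[OF Suc.prems(2)]]])
       (auto intro!: C_on_add[OF assms(2)] Suc.IH C_on_lower[OF Suc.prems(1)]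
          C_on_lower[OF Suc.prems(2)] C_on_SucD(2)[OF Suc.prems(1)] C_on_SucD(2)[OF Suc.prems(2)])
qed

lemma C_on_Pair:
  assumes "open U"
  shows "C_on n f U \<Longrightarrow> C_on n g U \<Longrightarrow> C_on n (\<lambda>x. (f x, g x)) U"
proof (induction n arbitrary: f g)
  case 0
  then show ?case by (auto intro: continuous_intros)
next
  case (Suc n)
  show ?case
    by (rule C_on_SucI[OF assms
          has_derivative_Pair[OF C_on_SucD(1)[OF Suc.prems(1)] C_on_SucD(1)[OF Suc.prems(2)]]])
       (use Suc.IH C_on_SucD(2)[OF Suc.prems(1)] C_on_SucD(2)[OF Suc.prems(2)] in auto)
qed

lemma C_on_sum:
  assumes "open U" "finite I" "\<And>i. i \<in> I \<Longrightarrow> C_on n (f i) U"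
  shows "C_on n (\<lambda>x. \<Sum>i\<in>I. f i x) U"
  using assms(2,3) by (induction I) (auto intro!: C_on_add C_on_const assms(1))

lemmas C_on_scaleR = C_on_bounded_bilinear[OF bounded_bilinear_scaleR]
lemmas C_on_mult = C_on_bounded_bilinear[OF bounded_bilinear_mult]
lemmas C_on_inner = C_on_bounded_bilinear[OF bounded_bilinear_inner]
lemmas C_on_cross3 =
  C_on_bounded_bilinear[OF bilinear_cross[unfolded bilinear_conv_bounded_bilinear]]
lemmas C_on_fst = C_on_bounded_linear[OF bounded_linear_fst]
lemmas C_on_snd = C_on_bounded_linear[OF bounded_linear_snd]
lemmas C_on_uminus = C_on_bounded_linear[OF bounded_linear_minus[OF bounded_linear_ident]]

lemma C_on_diff:
  "open U \<Longrightarrow> C_on n f U \<Longrightarrow> C_on n g U \<Longrightarrow> C_on n (\<lambda>x. f x - g x) U"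
  using C_on_add[OF _ _ C_on_uminus, of U n f g] by simp

text \<open>In the chain rule the derivative of the outer map is evaluated in a direction that varies
  with the point, whereas \<^const>\<open>C_on\<close> speaks of fixed directions. Expanding the direction in
  a basis, which needs a finite-dimensional middle space, separates the two dependencies.\<close>

lemma C_on_compose:
  fixes f :: "'a::real_normed_vector \<Rightarrow> 'b::euclidean_space"
  assumes "open U" "f ` U \<subseteq> V"
  shows "C_on n g V \<Longrightarrow> C_on n f U \<Longrightarrow> C_on n (\<lambda>x. g (f x)) U"
proof (induction n arbitrary: g)
  case 0
  then show ?case using assms(2) by (auto intro: continuous_on_compose2)
next
  case (Suc n)
  let ?Df = "\<lambda>x. frechet_derivative f (at x)" and ?Dg = "\<lambda>y. frechet_derivative g (at y)"
  show ?case
  proof (rule C_on_SucI[OF assms(1)])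
    fix x assume x: "x \<in> U"
    have g: "(g has_derivative ?Dg (f x)) (at (f x))"
      using x assms(2) by (intro C_on_SucD(1)[OF Suc.prems(1)]) auto
    have "((\<lambda>x. g (f x)) has_derivative (\<lambda>v. ?Dg (f x) (?Df x v))) (at x)"
      using has_derivative_compose[OF C_on_SucD(1)[OF Suc.prems(2) x] g] .
    moreover have "?Dg (f x) w = (\<Sum>b\<in>Basis. (w \<bullet> b) *\<^sub>R ?Dg (f x) b)" for w
    proof -
      have "?Dg (f x) (\<Sum>b\<in>Basis. (w \<bullet> b) *\<^sub>R b) = (\<Sum>b\<in>Basis. (w \<bullet> b) *\<^sub>R ?Dg (f x) b)"
        using has_derivative_linear[OF g] by (simp add: linear_sum linear_scale)
      then show ?thesis by (simp add: euclidean_representation)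
    qed
    ultimately show "((\<lambda>x. g (f x)) has_derivative
        (\<lambda>v. \<Sum>b\<in>Basis. (?Df x v \<bullet> b) *\<^sub>R ?Dg (f x) b)) (at x)"
      by (metis (no_types, lifting) ext)
  next
    fix v
    show "C_on n (\<lambda>x. \<Sum>b\<in>Basis. (?Df x v \<bullet> b) *\<^sub>R ?Dg (f x) b) U"
      by (rule C_on_sum[OF assms(1) finite_Basis]
            C_on_scaleR[OF assms(1)] C_on_inner[OF assms(1)] C_on_const[OF assms(1)]
            C_on_SucD(2)[OF Suc.prems(2)] 
            Suc.IH[OF C_on_SucD(2)[OF Suc.prems(1)] C_on_lower[OF Suc.prems(2)]])+
  qed
qed

lemma C_on_real_SucI:
  fixes f :: "real \<Rightarrow> real"
  assumes "open U" "\<And>x. x \<in> U \<Longrightarrow> (f has_field_derivative f' x) (at x)" "C_on n f' U"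
  shows "C_on (Suc n) f U"
proof (rule C_on_SucI[OF assms(1)])
  show "(f has_derivative (\<lambda>v. f' x * v)) (at x)" if "x \<in> U" for x
    using assms(2)[OF that] by (simp add: has_field_derivative_def)
  show "C_on n (\<lambda>x. f' x * v) U" for v
    by (rule C_on_mult[OF assms(1,3) C_on_const[OF assms(1)]])
qed

text \<open>Each of the two functions is, up to sign, the derivative of the other, so the induction carries both.\<close>

lemma C_on_sin_cos: "C_on n sin (UNIV :: real set) \<and> C_on n cos (UNIV :: real set)"
proof (induction n)
  case 0
  then show ?case by (auto intro: continuous_intros)
next
  case (Suc n)
  then have "C_on n (\<lambda>x::real. - sin x) UNIV" "C_on n (cos :: real \<Rightarrow> real) UNIV"
    by (auto intro: C_on_uminus)
  then show ?case
    using C_on_real_SucI[OF open_UNIV DERIV_sin] C_on_real_SucI[OF open_UNIV DERIV_cos] by blast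
qed

text \<open>The derivative \<open>- (1/x)\<^sup>2\<close> is a polynomial in the function itself.\<close>

lemma C_on_inverse_real: "C_on n inverse (- {0::real})"
proof (induction n)
  case 0
  then show ?case using continuous_on_inverse[OF continuous_on_id, of "- {0::real}"] by simp
next
  case (Suc n)
  have o: "open (- {0::real})" by (simp add: open_Compl)
  show ?case
  proof (rule C_on_real_SucI[OF o])
    show "(inverse has_field_derivative - (inverse x * inverse x)) (at x)" if "x \<in> - {0}" for x :: real
      using DERIV_inverse[of x UNIV] that by (simp add: power2_eq_square)
    show "C_on n (\<lambda>x. - (inverse x * inverse x)) (- {0::real})"
      by (rule C_on_uminus[OF o C_on_mult[OF o Suc Suc]])
  qed
qed

lemma C_on_inverse:
  fixes f :: "'a::real_normed_vector \<Rightarrow> real"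
  assumes "open U" "C_on n f U" "\<And>x. x \<in> U \<Longrightarrow> f x \<noteq> 0"
  shows "C_on n (\<lambda>x. inverse (f x)) U"
  by (rule C_on_compose[OF assms(1) _ C_on_inverse_real assms(2)]) (use assms(3) in auto)

text \<open>The derivative \<open>1 / (2 \<surd>x)\<close> is a smooth function of the square root itself.\<close>

lemma C_on_sqrt_pos: "C_on n sqrt {0<..}"
proof (induction n)
  case 0
  then show ?case using continuous_on_real_sqrt[OF continuous_on_id, of "{0<..}"] by simp
next
  case (Suc n)
  have "C_on n (\<lambda>x. inverse (sqrt x) * (1/2)) {0<..}"
  proof (rule C_on_mult[OF open_greaterThan C_on_inverse[OF open_greaterThan Suc]
          C_on_const[OF open_greaterThan]])
    show "sqrt x \<noteq> 0" if "x \<in> {0<..}" for x :: real using that by simp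
  qed
  moreover have "(sqrt has_field_derivative inverse (sqrt x) * (1/2)) (at x)" if "x \<in> {0<..}" for x
    using DERIV_real_sqrt[of x] that by simp
  ultimately show ?case
    by (intro C_on_real_SucI[OF open_greaterThan])
qed

lemma C_on_sqrt:
  assumes "open U" "C_on n f U" "\<And>x. x \<in> U \<Longrightarrow> f x > 0"
  shows "C_on n (\<lambda>x. sqrt (f x)) U"
proof (rule C_on_compose[OF assms(1) _ C_on_sqrt_pos assms(2)])
  show "f ` U \<subseteq> {0<..}" using assms(3) by auto
qed

lemma C_on_arctan_UNIV: "C_on n arctan UNIV"
proof (cases n)
  case (Suc m)
  have "C_on m (\<lambda>x::real. inverse (1 + x * x)) UNIV"
  proof (intro C_on_inverse C_on_add C_on_mult C_on_const C_on_id)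
    show "1 + x * x \<noteq> 0" for x :: real
      using zero_le_square[of x] by linarith
  qed auto
  moreover have "(arctan has_field_derivative inverse (1 + x * x)) (at x)" for x
    using DERIV_arctan[of x] by (simp add: power2_eq_square)
  ultimately show ?thesis unfolding Suc
    by (intro C_on_real_SucI[OF open_UNIV])
qed (simp add: continuous_on_arctan)

lemma C_on_sin_cos_arctan:
  fixes f :: "'a::real_normed_vector \<Rightarrow> real"
  assumes "open U" "C_on n f U"
  shows "C_on n (\<lambda>x. sin (f x)) U" "C_on n (\<lambda>x. cos (f x)) U" "C_on n (\<lambda>x. arctan (f x)) U"
  using C_on_sin_cos[of n] C_on_arctan_UNIV[of n]
    C_on_compose[OF assms(1) subset_UNIV _ assms(2), of sin]
    C_on_compose[OF assms(1) subset_UNIV _ assms(2), of cos]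
    C_on_compose[OF assms(1) subset_UNIV _ assms(2), of arctan] by blast+

lemma smooth_on_vector_derivative:
  assumes "smooth_on UNIV \<gamma>"
  shows "smooth_on UNIV (\<lambda>s. vector_derivative \<gamma> (at s))"
proof -
  have D: "\<gamma> differentiable (at s)" for s
    using assms C_on.simps(2)[of 0 \<gamma> UNIV] unfolding smooth_on_def by blast
  have "vector_derivative \<gamma> (at s) = frechet_derivative \<gamma> (at s) 1" for s
    using D[of s] by (simp add: frechet_derivative_eq_vector_derivative)
  moreover have "C_on n (\<lambda>s. frechet_derivative \<gamma> (at s) 1) UNIV" for n
    using assms unfolding smooth_on_def by (metis C_on.simps(2))
  ultimately show ?thesis unfolding smooth_on_def by simp
qed

section \<open>The angle from a plane vector\<close>

text \<open>For \<open>a = r cos \<phi>\<close> and \<open>b = r sin \<phi>\<close> with \<open>r > 0\<close>, \<open>angle_denom\<close> is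
  \<open>r (1 + cos (\<theta> - \<phi>))\<close>, which is positive exactly off the ray opposite to \<open>(a, b)\<close>, and
  \<open>angle_offset\<close> is the representative of \<open>\<theta> - \<phi>\<close> in \<open>(-\<pi>, \<pi>)\<close>. The half-angle formula is preferred to
  an inverse sine, which is not smooth at the two ends \<open>\<plusminus>\<pi>/2\<close> of the half circle.\<close>

definition angle_denom :: "real \<Rightarrow> real \<Rightarrow> real \<Rightarrow> real" where
  "angle_denom a b \<theta> = sqrt (a\<^sup>2 + b\<^sup>2) + (a * cos \<theta> + b * sin \<theta>)"

definition angle_offset :: "real \<Rightarrow> real \<Rightarrow> real \<Rightarrow> real" where
  "angle_offset a b \<theta> = 2 * arctan ((a * sin \<theta> - b * cos \<theta>) / angle_denom a b \<theta>)"

lemma cos_sin_add_int_period: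
  "cos (\<theta> + of_int k * (2 * pi)) = cos \<theta>" "sin (\<theta> + of_int k * (2 * pi)) = sin (\<theta>::real)"
  using sin_cos_eq_iff[of "\<theta> + of_int k * (2 * pi)" \<theta>] by (auto simp: mult_ac)

lemma polar_coordinates:
  assumes "a \<noteq> 0 \<or> b \<noteq> (0::real)"
  obtains r \<phi> where "r > 0" "a = r * cos \<phi>" "b = r * sin \<phi>"
proof -
  define r where "r = sqrt (a\<^sup>2 + b\<^sup>2)"
  have "a\<^sup>2 + b\<^sup>2 > 0" using assms by (simp add: sum_power2_gt_zero_iff)
  then have r: "r > 0" "r\<^sup>2 = a\<^sup>2 + b\<^sup>2" by (auto simp: r_def)
  have "(a / r)\<^sup>2 + (b / r)\<^sup>2 = 1"
    using r(1) by (simp add: power_divide r(2)[symmetric] flip: add_divide_distrib)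
  then obtain \<phi> where "a / r = cos \<phi>" "b / r = sin \<phi>" using sincos_total_2pi by metis
  with r show ?thesis by (intro that[of r \<phi>]) (auto simp: field_simps)
qed

lemma polar_radius: "r > 0 \<Longrightarrow> sqrt ((r * cos \<phi>)\<^sup>2 + (r * sin \<phi>)\<^sup>2) = r"
  by (simp add: power_mult_distrib flip: distrib_left)

lemma polar_projection: "(r * cos \<phi>) * cos \<theta> + (r * sin \<phi>) * sin \<theta> = r * cos (\<theta> - \<phi>)"
  for r \<theta> \<phi> :: real
  by (simp add: cos_diff algebra_simps)

text \<open>The quotient inside \<^const>\<open>angle_offset\<close> is \<open>sin t / (1 + cos t) = tan (t / 2)\<close>.\<close>

lemma angle_offset_polar:
  assumes "r > 0" "\<bar>\<theta> - \<phi>\<bar> < pi"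
  shows "angle_offset (r * cos \<phi>) (r * sin \<phi>) \<theta> = \<theta> - \<phi>"
proof -
  define t where "t = \<theta> - \<phi>"
  have "r * cos \<phi> * sin \<theta> - r * sin \<phi> * cos \<theta> = r * sin t"
    by (simp add: t_def sin_diff algebra_simps)
  moreover have "angle_denom (r * cos \<phi>) (r * sin \<phi>) \<theta> = r * (cos t + 1)"
    unfolding angle_denom_def polar_radius[OF assms(1)] polar_projection
    by (simp add: t_def algebra_simps)
  ultimately have "angle_offset (r * cos \<phi>) (r * sin \<phi>) \<theta> = 2 * arctan (tan (t / 2))"
    using assms(1) tan_half[of "t / 2"] by (simp add: angle_offset_def)
  also have "arctan (tan (t / 2)) = t / 2"
    using assms(2) by (intro arctan_tan) (auto simp: t_def)
  finally show ?thesis by (simp add: t_def)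
qed

text \<open>Positivity of the denominator excludes the direction opposite to \<open>(a, b)\<close>, so the argument
  of \<open>(a, b)\<close> can be chosen at distance less than \<open>\<pi>\<close> from \<open>\<theta>\<close>.\<close>

lemma polar_coordinates_near:
  assumes "angle_denom a b \<theta> > 0"
  obtains r \<phi> where "r > 0" "a = r * cos \<phi>" "b = r * sin \<phi>" "\<bar>\<theta> - \<phi>\<bar> < pi"
proof -
  have "a \<noteq> 0 \<or> b \<noteq> 0" using assms by (auto simp: angle_denom_def)
  then obtain r \<psi> where r: "r > 0" and ab: "a = r * cos \<psi>" "b = r * sin \<psi>"
    by (rule polar_coordinates)
  define k where "k = \<lfloor>(\<theta> - \<psi> + pi) / (2 * pi)\<rfloor>"
  define \<phi> where "\<phi> = \<psi> + of_int k * (2 * pi)"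
  have ab': "a = r * cos \<phi>" "b = r * sin \<phi>"
    by (simp_all add: ab \<phi>_def cos_sin_add_int_period)
  have "of_int k \<le> (\<theta> - \<psi> + pi) / (2 * pi)" "(\<theta> - \<psi> + pi) / (2 * pi) < of_int k + 1"
    unfolding k_def by linarith+
  then have bounds: "- pi \<le> \<theta> - \<phi>" "\<theta> - \<phi> < pi"
    using pi_gt_zero by (simp_all add: \<phi>_def field_simps)
  \<comment> \<open>The floor leaves one boundary point, where the denominator vanishes.\<close>
  have "0 < r * (1 + cos (\<theta> - \<phi>))"
    using assms unfolding ab' angle_denom_def polar_radius[OF r] polar_projection
    by (simp add: algebra_simps)
  then have "\<theta> - \<phi> \<noteq> - pi" by auto
  with bounds show ?thesis by (intro that[OF r ab']) auto
qed

text \<open>On \<open>(-\<pi>, \<pi>)\<close> the cosine is nonnegative only within \<open>\<pi>/2\<close> of zero.\<close>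

lemma angle_offset_le_pi_half:
  assumes "a \<noteq> 0 \<or> b \<noteq> 0" "a * cos \<theta> + b * sin \<theta> \<ge> 0"
  shows "angle_denom a b \<theta> > 0" "\<bar>angle_offset a b \<theta>\<bar> \<le> pi / 2"
proof -
  show pos: "angle_denom a b \<theta> > 0"
    using assms unfolding angle_denom_def
    by (intro add_pos_nonneg) (simp_all add: sum_power2_gt_zero_iff)
  obtain r \<phi> where r: "r > 0" "a = r * cos \<phi>" "b = r * sin \<phi>" "\<bar>\<theta> - \<phi>\<bar> < pi"
    using polar_coordinates_near[OF pos] .
  have "r * cos (\<theta> - \<phi>) \<ge> 0" using assms(2) unfolding r polar_projection .
  then have "cos \<bar>\<theta> - \<phi>\<bar> \<ge> 0" using r(1) by (simp add: zero_le_mult_iff)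
  then have "\<bar>\<theta> - \<phi>\<bar> \<le> pi / 2"
    using cos_monotone_0_pi[of "pi / 2" "\<bar>\<theta> - \<phi>\<bar>"] r(4) by fastforce
  then show "\<bar>angle_offset a b \<theta>\<bar> \<le> pi / 2"
    using angle_offset_polar[OF r(1,4)] r by simp
qed

lemma angle_offset_inj:
  assumes "angle_denom a b \<theta> > 0" "angle_denom a b \<theta>' > 0"
    and "angle_offset a b \<theta> = angle_offset a b \<theta>'"
  shows "proj (2 * pi) \<theta> = proj (2 * pi) \<theta>'"
proof -
  obtain r \<phi> where r: "r > 0" "a = r * cos \<phi>" "b = r * sin \<phi>" "\<bar>\<theta> - \<phi>\<bar> < pi"
    using polar_coordinates_near[OF assms(1)] .
  obtain r' \<phi>' where r': "r' > 0" "a = r' * cos \<phi>'" "b = r' * sin \<phi>'" "\<bar>\<theta>' - \<phi>'\<bar> < pi"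
    using polar_coordinates_near[OF assms(2)] .
  have "r = r'"
    using polar_radius[OF r(1), of \<phi>] polar_radius[OF r'(1), of \<phi>'] r r' by simp
  then have "sin \<phi>' = sin \<phi> \<and> cos \<phi>' = cos \<phi>" using r r' by simp
  then obtain n :: int where "\<phi>' = \<phi> + 2 * pi * n" using sin_cos_eq_iff by metis
  moreover have "\<theta> - \<phi> = \<theta>' - \<phi>'"
    using assms(3) angle_offset_polar[OF r(1,4)] angle_offset_polar[OF r'(1,4)] r r' by simp
  ultimately show ?thesis
    unfolding proj_eq_iff by (intro exI[of _ n]) (simp add: algebra_simps)
qed

text \<open>Since \<open>\<theta>\<^sub>0 - angle_offset a b \<theta>\<^sub>0\<close> is an argument of \<open>(a, b)\<close>, and one that depends smoothly on
  \<open>(a, b)\<close> for fixed \<open>\<theta>\<^sub>0\<close>, this is the smooth local inverse of the offset.\<close>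

lemma angle_offset_prescribed:
  assumes "angle_denom a b \<theta>\<^sub>0 > 0" "\<bar>t\<bar> \<le> pi / 2"
  defines "\<theta> \<equiv> \<theta>\<^sub>0 - angle_offset a b \<theta>\<^sub>0 + t"
  shows "angle_offset a b \<theta> = t" "a * cos \<theta> + b * sin \<theta> \<ge> 0"
proof -
  obtain r \<phi> where r: "r > 0" "a = r * cos \<phi>" "b = r * sin \<phi>" "\<bar>\<theta>\<^sub>0 - \<phi>\<bar> < pi"
    using polar_coordinates_near[OF assms(1)] .
  have \<theta>: "\<theta> = \<phi> + t" using angle_offset_polar[OF r(1,4)] r by (simp add: \<theta>_def)
  have "\<bar>\<theta> - \<phi>\<bar> < pi" using assms(2) pi_gt_zero unfolding \<theta> by linarith
  then show "angle_offset a b \<theta> = t" using angle_offset_polar[OF r(1)] r \<theta> by simp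
  have "cos t \<ge> 0" using assms(2) by (intro cos_ge_zero) auto
  then show "a * cos \<theta> + b * sin \<theta> \<ge> 0"
    unfolding r polar_projection using r(1) by (simp add: \<theta>)
qed

lemma angle_denom_offset_period:
  "angle_denom a b (\<theta> + of_int k * (2 * pi)) = angle_denom a b \<theta>"
  "angle_offset a b (\<theta> + of_int k * (2 * pi)) = angle_offset a b \<theta>"
  by (simp_all only: angle_denom_def angle_offset_def cos_sin_add_int_period)

section \<open>The covering projections of tori\<close>

lemma proj_eq_iff_translate: "proj T x = proj T y \<longleftrightarrow> (\<exists>k::int. y = x + of_int k * T)"
  unfolding proj_eq_iff by (simp add: algebra_simps)

lemma mem_proj: "x + of_int k * T \<in> proj T x"
  by (auto simp: proj_def period_rel_def)

lemma flat_dist_le: "flat_dist (proj T x) (proj T y) \<le> \<bar>x + of_int k * T - y\<bar>"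
  using setdist_le_dist[OF mem_proj[of x k T] mem_proj[of y 0 T]]
  by (simp add: flat_dist_def dist_real_def)

text \<open>The saturation of an open set is the union of its translates by multiples of the period.\<close>

lemma open_map_proj: "open_map euclidean (circle_topology T) (proj T)"
  unfolding open_map_def
proof (intro allI impI)
  fix W :: "real set" assume "openin euclidean W"
  then have W: "open W" by simp
  have "{x. proj T x \<in> proj T ` W} = (\<Union>k::int. (\<lambda>x. x + of_int k * T) -` W)"
    by (auto simp: proj_eq_iff_translate image_iff)
  moreover have "open ((\<lambda>x. x + of_int k * T) -` W)" for k :: int
    by (intro open_vimage W continuous_intros)
  ultimately have "open {x. proj T x \<in> proj T ` W}" by auto
  then show "openin (circle_topology T) (proj T ` W)"
    by (auto simp: openin_circle circle_eq)
qed

lemma open_map_map_prod: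
  fixes p :: "'a::topological_space \<Rightarrow> 'x" and q :: "'b::topological_space \<Rightarrow> 'y"
  assumes "open_map euclidean X p" "open_map euclidean Y q"
  shows "open_map euclidean (prod_topology X Y) (map_prod p q)"
  unfolding open_map_def
proof (intro allI impI)
  fix W :: "('a \<times> 'b) set" assume "openin euclidean W"
  then have W: "open W" by simp
  show "openin (prod_topology X Y) (map_prod p q ` W)"
    unfolding openin_prod_topology_alt
  proof (intro allI impI)
    fix x y assume "(x, y) \<in> map_prod p q ` W"
    then obtain a b where ab: "(a, b) \<in> W" "x = p a" "y = q b" by auto
    then obtain A B where AB: "open A" "open B" "(a, b) \<in> A \<times> B" "A \<times> B \<subseteq> W"
      using open_prod_elim[OF W] by metis
    then show "\<exists>U V. openin X U \<and> openin Y V \<and> x \<in> U \<and> y \<in> V \<and> U \<times> V \<subseteq> map_prod p q ` W"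
      using assms ab unfolding open_map_def
      by (intro exI[of _ "p ` A"] exI[of _ "q ` B"]) force
  qed
qed

text \<open>Closures in a torus can thus be tested upstairs, with open sets of a Euclidean space.\<close>

lemma not_in_closure_of_open_map:
  assumes "open_map euclidean X p" "open W" "x \<in> W" "\<And>y. y \<in> W \<Longrightarrow> p y \<notin> E"
  shows "p x \<notin> X closure_of E"
  using assms unfolding open_map_def in_closure_of
  by (metis (no_types, lifting) image_iff open_openin)

section \<open>The closed standard set avoids diagonal and special pairs\<close>

text \<open>The pairs at flat distance less than \<open>\<delta>\<close> form an open neighbourhood of the diagonal that the
  standard set does not meet.\<close>

lemma closed_standard_set_not_diagonal:
  assumes "\<delta> > 0" "proj T s\<^sub>1 = proj T s\<^sub>2"
  shows "(proj T s\<^sub>1, proj T s\<^sub>2) \<notin> closed_standard_set T \<gamma> \<delta>"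
proof -
  obtain k :: int where k: "s\<^sub>2 = s\<^sub>1 + of_int k * T" using assms(2) proj_eq_iff_translate by blast
  let ?W = "{x :: real \<times> real. \<bar>fst x + of_int k * T - snd x\<bar> < \<delta>}"
  have "map_prod (proj T) (proj T) (s\<^sub>1, s\<^sub>2) \<notin>
      prod_topology (circle_topology T) (circle_topology T) closure_of standard_set T \<gamma> \<delta>"
  proof (rule not_in_closure_of_open_map[OF open_map_map_prod[OF open_map_proj open_map_proj]])
    show "open ?W" by (intro open_Collect_less continuous_intros)
    show "(s\<^sub>1, s\<^sub>2) \<in> ?W" using assms(1) k by simp
    fix y assume "y \<in> ?W"
    then have "flat_dist (proj T (fst y)) (proj T (snd y)) \<le> \<delta>"
      using flat_dist_le[of T "fst y" "snd y" k] by simp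
    then show "map_prod (proj T) (proj T) y \<notin> standard_set T \<gamma> \<delta>"
      by (cases y) (auto simp: standard_set_def weakly_diagonal_def circle_eq)
  qed
  then show ?thesis by (simp add: closed_standard_set_def)
qed

text \<open>Here the open neighbourhood is the interior of the square of half-side \<open>\<delta>\<close> around the
  special pair.\<close>

lemma closed_standard_set_not_special:
  assumes "\<delta> > 0" "(proj T s\<^sub>1, proj T s\<^sub>2) \<in> special_pairs T \<gamma>"
  shows "(proj T s\<^sub>1, proj T s\<^sub>2) \<notin> closed_standard_set T \<gamma> \<delta>"
proof -
  let ?W = "{x :: real \<times> real. \<bar>fst x - s\<^sub>1\<bar> < \<delta> \<and> \<bar>snd x - s\<^sub>2\<bar> < \<delta>}"
  have "map_prod (proj T) (proj T) (s\<^sub>1, s\<^sub>2) \<notin>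
      prod_topology (circle_topology T) (circle_topology T) closure_of standard_set T \<gamma> \<delta>"
  proof (rule not_in_closure_of_open_map[OF open_map_map_prod[OF open_map_proj open_map_proj]])
    show "open ?W" by (intro open_Collect_conj open_Collect_less continuous_intros)
    show "(s\<^sub>1, s\<^sub>2) \<in> ?W" using assms(1) by simp
    fix y assume "y \<in> ?W"
    then have "flat_dist (proj T (fst y)) (proj T s\<^sub>1) \<le> \<delta>" "flat_dist (proj T (snd y)) (proj T s\<^sub>2) \<le> \<delta>"
      using flat_dist_le[of T "fst y" s\<^sub>1 0] flat_dist_le[of T "snd y" s\<^sub>2 0] by auto
    then show "map_prod (proj T) (proj T) y \<notin> standard_set T \<gamma> \<delta>"
      using assms(2) by (cases y) (fastforce simp: standard_set_def weakly_special_def circle_eq)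
  qed
  then show ?thesis by (simp add: closed_standard_set_def)
qed

lemma closed_standard_set_lift:
  assumes "P \<in> closed_standard_set T \<gamma> \<delta>"
  obtains s\<^sub>1 s\<^sub>2 where "P = (proj T s\<^sub>1, proj T s\<^sub>2)"
proof -
  have "P \<in> circle T \<times> circle T"
    using assms closure_of_subset_topspace
    unfolding closed_standard_set_def by (fastforce simp: topspace_circle)
  then show ?thesis using that by (auto simp: circle_eq)
qed

section \<open>Diffeomorphisms from maps of covering spaces\<close>

text \<open>A map \<open>h\<close> upstairs that respects the fibres descends to \<open>f\<close> with \<open>f \<circ> p = q \<circ> h\<close>. Only local lifts
  \<open>G\<close> of the inverse are asked for, as a global one need not exist: by injectivity of \<open>f\<close> on \<open>A\<close>,
  any point of \<open>A\<close> that \<open>f\<close> sends to \<open>q z\<close> is the value of the inverse at \<open>q z\<close>. The existence of the \<open>G\<close>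
  therefore gives both surjectivity and smoothness of the inverse.\<close>

lemma diffeomorphic_if_lifts:
  fixes p :: "'a::euclidean_space \<Rightarrow> 'x" and q :: "'b::euclidean_space \<Rightarrow> 'y" and h :: "'a \<Rightarrow> 'b"
  assumes sub: "A \<subseteq> range p" "B \<subseteq> range q"
    and respects: "\<And>x y. p x = p y \<Longrightarrow> q (h x) = q (h y)"
    and maps: "\<And>x. p x \<in> A \<Longrightarrow> q (h x) \<in> B"
    and smooth: "\<And>x. p x \<in> A \<Longrightarrow> \<exists>U. open U \<and> x \<in> U \<and> smooth_on U h"
    and inj: "\<And>x y. p x \<in> A \<Longrightarrow> p y \<in> A \<Longrightarrow> q (h x) = q (h y) \<Longrightarrow> p x = p y"
    and lift: "\<And>y. q y \<in> B \<Longrightarrow> \<exists>V G. open V \<and> y \<in> V \<and> smooth_on V G \<and>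
        (\<forall>z\<in>V. q z \<in> B \<longrightarrow> p (G z) \<in> A \<and> q (h (G z)) = q z)"
  shows "diffeomorphic p q A B"
proof -
  define f where "f X = q (h (SOME x. p x = X))" for X
  have f: "f (p x) = q (h x)" for x
    unfolding f_def by (rule respects) (rule someI[of _ x], rule refl)
  have inj_f: "inj_on f A"
  proof (rule inj_onI)
    fix X Y assume XY: "X \<in> A" "Y \<in> A" "f X = f Y"
    then obtain x y where "X = p x" "Y = p y" using sub(1) by blast
    with XY show "X = Y" using inj[of x y] f by simp
  qed
  have f_A: "f X \<in> B" if "X \<in> A" for X
  proof -
    obtain x where "X = p x" using sub(1) \<open>X \<in> A\<close> by blast
    with that show ?thesis using maps[of x] f by simp
  qed
  have G: "p (G z) \<in> A \<and> the_inv_into A f (q z) = p (G z) \<and> f (p (G z)) = q z"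
    if "p (G z) \<in> A \<and> q (h (G z)) = q z" for G z
    using the_inv_into_f_eq[OF inj_f, of "p (G z)" "q z"] that f[of "G z"] by simp
  have B: "Y \<in> f ` A" if Y: "Y \<in> B" for Y
  proof -
    obtain y where y: "Y = q y" using sub(2) Y by auto
    then obtain K where "p (K y) \<in> A \<and> q (h (K y)) = q y" using lift[of y] Y by blast
    then have "p (K y) \<in> A" "f (p (K y)) = Y" using f y by auto
    then show ?thesis by blast
  qed
  show ?thesis
    unfolding diffeomorphic_def
  proof (intro exI conjI)
    show "f ` A \<subseteq> B" using f_A by blast
    show "the_inv_into A f ` B \<subseteq> A"
      using B the_inv_into_into[OF inj_f _ subset_refl] by blast
    show "\<forall>X\<in>A. the_inv_into A f (f X) = X" by (simp add: the_inv_into_f_f inj_f)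
    show "\<forall>Y\<in>B. f (the_inv_into A f Y) = Y" using B by (simp add: f_the_inv_into_f inj_f)
    show "smooth_map p q A f"
      unfolding smooth_map_def
    proof (intro allI impI)
      fix x assume "p x \<in> A"
      then obtain U where "open U" "x \<in> U" "smooth_on U h" using smooth by blast
      then show "\<exists>U g. open U \<and> x \<in> U \<and> smooth_on U g \<and> (\<forall>y\<in>U. p y \<in> A \<longrightarrow> q (g y) = f (p y))"
        using f by (intro exI[of _ U] exI[of _ h]) simp
    qed
    show "smooth_map q p B (the_inv_into A f)"
      unfolding smooth_map_def
    proof (intro allI impI)
      fix y assume "q y \<in> B"
      then obtain V K where "open V" "y \<in> V" "smooth_on V K"
        "\<forall>z\<in>V. q z \<in> B \<longrightarrow> p (K z) \<in> A \<and> q (h (K z)) = q z"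
        using lift by blast
      then show "\<exists>U g. open U \<and> y \<in> U \<and> smooth_on U g \<and>
          (\<forall>z\<in>U. q z \<in> B \<longrightarrow> p (g z) = the_inv_into A f (q z))"
        using G by (intro exI[of _ V] exI[of _ K]) auto
    qed
  qed
qed

section \<open>The normal frame of the knot\<close>

lemma smooth_on_velocity: "smooth_on UNIV \<gamma> \<Longrightarrow> smooth_on UNIV (velocity \<gamma>)"
  using smooth_on_vector_derivative[of \<gamma>] unfolding velocity_def[abs_def] .

lemma smooth_on_acceleration: "smooth_on UNIV \<gamma> \<Longrightarrow> smooth_on UNIV (acceleration \<gamma>)"
  using smooth_on_vector_derivative[OF smooth_on_velocity[of \<gamma>]]
  unfolding acceleration_def[abs_def] .

lemma smooth_on_normal:
  assumes "smooth_on UNIV \<gamma>" "\<And>s. acceleration \<gamma> s \<noteq> 0"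
  shows "smooth_on UNIV (normal \<gamma>)"
  unfolding smooth_on_def
proof
  fix n
  let ?a = "acceleration \<gamma>"
  have a: "C_on n ?a UNIV" using smooth_on_acceleration[OF assms(1)] by (simp add: smooth_on_def)
  have "C_on n (\<lambda>s. inverse (sqrt (?a s \<bullet> ?a s)) *\<^sub>R ?a s) UNIV"
  proof (rule C_on_scaleR[OF open_UNIV C_on_inverse[OF open_UNIV C_on_sqrt[OF open_UNIV
          C_on_inner[OF open_UNIV a a]]] a])
    show "?a s \<bullet> ?a s > 0" "sqrt (?a s \<bullet> ?a s) \<noteq> 0" for s using assms(2)[of s] by auto
  qed
  then show "C_on n (normal \<gamma>) UNIV"
    by (simp add: normal_def[abs_def] norm_eq_sqrt_inner)
qed

lemma smooth_on_binormal:
  assumes "smooth_on UNIV \<gamma>" "\<And>s. acceleration \<gamma> s \<noteq> 0"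
  shows "smooth_on UNIV (binormal \<gamma>)"
  using smooth_on_velocity[OF assms(1)] smooth_on_normal[OF assms]
  unfolding smooth_on_def binormal_def[abs_def] by (blast intro: C_on_cross3[OF open_UNIV])

text \<open>Differentiate the constant function \<open>velocity \<gamma> s \<bullet> velocity \<gamma> s = 1\<close>.\<close>

lemma velocity_perp_acceleration:
  assumes "smooth_on UNIV \<gamma>" "\<And>s. norm (velocity \<gamma> s) = 1"
  shows "velocity \<gamma> s \<bullet> acceleration \<gamma> s = 0"
proof -
  let ?v = "velocity \<gamma>"
  have "C_on (Suc 0) ?v UNIV" using smooth_on_velocity[OF assms(1)] by (simp only: smooth_on_def)
  then have "?v differentiable (at s)" by simp
  then have "(?v has_vector_derivative acceleration \<gamma> s) (at s)"
    unfolding acceleration_def by (simp only: vector_derivative_works)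
  then have "(?v has_derivative (\<lambda>h. h *\<^sub>R acceleration \<gamma> s)) (at s)"
    by (simp add: has_vector_derivative_def)
  note has_derivative_inner[OF this this]
  moreover have "?v t \<bullet> ?v t = 1" for t
    using assms(2)[of t] by (simp add: norm_eq_1)
  ultimately have "((\<lambda>t. 1::real) has_derivative
      (\<lambda>h. ?v s \<bullet> (h *\<^sub>R acceleration \<gamma> s) + (h *\<^sub>R acceleration \<gamma> s) \<bullet> ?v s)) (at s)"
    by simp
  then have "(\<lambda>h. ?v s \<bullet> (h *\<^sub>R acceleration \<gamma> s) + (h *\<^sub>R acceleration \<gamma> s) \<bullet> ?v s) = (\<lambda>h. 0)"
    using has_derivative_unique has_derivative_const by blast
  from fun_cong[OF this, of 1] show ?thesis by (simp add: inner_commute)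
qed

text \<open>The part \<open>u\<close> of \<open>w\<close> orthogonal to \<open>v\<close> satisfies \<open>u \<times> (v \<times> n) = 0\<close> by Lagrange's identity, and
  \<open>u \<bullet> (v \<times> n) = 0\<close>; as \<open>v \<times> n\<close> is nonzero, \<open>u\<close> vanishes.\<close>

lemma eq_tangential_component:
  fixes v n w :: "real^3"
  assumes "norm v = 1" "n \<noteq> 0" "v \<bullet> n = 0" "w \<bullet> n = 0" "w \<bullet> cross3 v n = 0"
  shows "w = (w \<bullet> v) *\<^sub>R v"
proof -
  define u where "u = w - (w \<bullet> v) *\<^sub>R v"
  have v: "v \<bullet> v = 1" using assms(1) by (simp add: norm_eq_1)
  have u: "u \<bullet> v = 0" "u \<bullet> n = 0" "u \<bullet> cross3 v n = 0"
    using assms v by (simp_all add: u_def inner_diff_left dot_cross_self)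
  have "cross3 u (cross3 v n) = 0" using u by (simp add: Lagrange)
  moreover have "cross3 v n \<noteq> 0"
    using norm_and_cross_eq_0[of v n] assms(1,2,3) by auto
  ultimately have "u = 0" using u(3) norm_and_cross_eq_0[of u "cross3 v n"] by auto
  then show ?thesis by (simp add: u_def)
qed

lemma periodic_int_multiple:
  fixes f :: "real \<Rightarrow> 'a"
  assumes "\<And>s. f (s + T) = f s"
  shows "f (s + of_int k * T) = f s"
proof -
  have nat: "f (s + of_nat m * T) = f s" for s and m
  proof (induction m)
    case (Suc m)
    have "f (s + of_nat (Suc m) * T) = f ((s + of_nat m * T) + T)" by (simp add: algebra_simps)
    then show ?case using assms Suc by simp
  qed simp
  show ?thesis
  proof (cases "k \<ge> 0")
    case True
    then show ?thesis using nat[of s "nat k"] by simp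
  next
    case False
    then show ?thesis using nat[of "s + of_int k * T" "nat (- k)"] by simp
  qed
qed

lemma periodic_vector_derivative:
  fixes f :: "real \<Rightarrow> 'a::real_normed_vector"
  assumes "\<And>s. f (s + c) = f s"
  shows "vector_derivative f (at (s + c)) = vector_derivative f (at s)"
proof -
  have shift: "(f has_vector_derivative D) (at s)"
    if "(f has_vector_derivative D) (at (s + c))" "\<And>s. f (s + c) = f s" for s c D
  proof -
    have "((\<lambda>x. x + c) has_derivative (\<lambda>h. h)) (at s)"
      by (auto intro!: derivative_eq_intros)
    then have "((\<lambda>x. f (x + c)) has_derivative (\<lambda>h. h *\<^sub>R D)) (at s)"
      using has_derivative_compose[of "\<lambda>x. x + c" "\<lambda>h. h" s UNIV f "\<lambda>h. h *\<^sub>R D"] that(1)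
      by (simp add: has_vector_derivative_def)
    then show ?thesis using that(2) by (simp add: has_vector_derivative_def)
  qed
  have "f (s - c) = f s" for s using assms[of "s - c"] by simp
  then have "(f has_vector_derivative D) (at (s + c)) \<longleftrightarrow> (f has_vector_derivative D) (at s)" for D
    using shift[of D s c] shift[of D "s + c" "- c"] assms by auto
  then show ?thesis by (simp add: vector_derivative_def)
qed

lemma frame_periodic:
  assumes "\<And>s. \<gamma> (s + c) = \<gamma> s"
  shows "velocity \<gamma> (s + c) = velocity \<gamma> s" "acceleration \<gamma> (s + c) = acceleration \<gamma> s"
    "normal \<gamma> (s + c) = normal \<gamma> s" "binormal \<gamma> (s + c) = binormal \<gamma> s"
proof -
  have v: "velocity \<gamma> (s + c) = velocity \<gamma> s" for s
    unfolding velocity_def by (rule periodic_vector_derivative) (rule assms)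
  have a: "acceleration \<gamma> (s + c) = acceleration \<gamma> s" for s
    unfolding acceleration_def by (rule periodic_vector_derivative) (rule v)
  show "velocity \<gamma> (s + c) = velocity \<gamma> s" "acceleration \<gamma> (s + c) = acceleration \<gamma> s"
    "normal \<gamma> (s + c) = normal \<gamma> s" "binormal \<gamma> (s + c) = binormal \<gamma> s"
    by (simp_all add: normal_def binormal_def v a)
qed

section \<open>The chord in the normal planes at its ends\<close>

text \<open>The base point \<open>s\<close> of the frame is a separate argument, so that both ends of the chord are
  treated at once, by \<open>s = s\<^sub>1\<close> and \<open>s = s\<^sub>2\<close>.\<close>

definition chord_normal :: "(real \<Rightarrow> real^3) \<Rightarrow> real \<Rightarrow> real \<Rightarrow> real \<Rightarrow> real" where
  "chord_normal \<gamma> s s\<^sub>1 s\<^sub>2 = (\<gamma> s\<^sub>2 - \<gamma> s\<^sub>1) \<bullet> normal \<gamma> s"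

definition chord_binormal :: "(real \<Rightarrow> real^3) \<Rightarrow> real \<Rightarrow> real \<Rightarrow> real \<Rightarrow> real" where
  "chord_binormal \<gamma> s s\<^sub>1 s\<^sub>2 = (\<gamma> s\<^sub>2 - \<gamma> s\<^sub>1) \<bullet> binormal \<gamma> s"

definition chord_denom :: "(real \<Rightarrow> real^3) \<Rightarrow> real \<Rightarrow> real \<Rightarrow> real \<Rightarrow> real \<Rightarrow> real" where
  "chord_denom \<gamma> s s\<^sub>1 s\<^sub>2 = angle_denom (chord_normal \<gamma> s s\<^sub>1 s\<^sub>2) (chord_binormal \<gamma> s s\<^sub>1 s\<^sub>2)"

definition chord_angle :: "(real \<Rightarrow> real^3) \<Rightarrow> real \<Rightarrow> real \<Rightarrow> real \<Rightarrow> real \<Rightarrow> real" where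
  "chord_angle \<gamma> s s\<^sub>1 s\<^sub>2 = angle_offset (chord_normal \<gamma> s s\<^sub>1 s\<^sub>2) (chord_binormal \<gamma> s s\<^sub>1 s\<^sub>2)"

lemma F_eq_chord:
  "F1 \<gamma> s\<^sub>1 \<theta>\<^sub>1 s\<^sub>2 \<theta>\<^sub>2 = chord_normal \<gamma> s\<^sub>1 s\<^sub>1 s\<^sub>2 * cos \<theta>\<^sub>1 + chord_binormal \<gamma> s\<^sub>1 s\<^sub>1 s\<^sub>2 * sin \<theta>\<^sub>1"
  "F2 \<gamma> s\<^sub>1 \<theta>\<^sub>1 s\<^sub>2 \<theta>\<^sub>2 = chord_normal \<gamma> s\<^sub>2 s\<^sub>1 s\<^sub>2 * cos \<theta>\<^sub>2 + chord_binormal \<gamma> s\<^sub>2 s\<^sub>1 s\<^sub>2 * sin \<theta>\<^sub>2"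
  by (simp_all add: F1_def F2_def normal_vector_def chord_normal_def chord_binormal_def inner_add_right)

lemma F_periodic:
  assumes "\<And>s. \<gamma> (s + T) = \<gamma> s"
    and "proj T s\<^sub>1 = proj T s\<^sub>1'" "proj T s\<^sub>2 = proj T s\<^sub>2'"
    and "proj (2 * pi) \<theta>\<^sub>1 = proj (2 * pi) \<theta>\<^sub>1'" "proj (2 * pi) \<theta>\<^sub>2 = proj (2 * pi) \<theta>\<^sub>2'"
  shows "F1 \<gamma> s\<^sub>1' \<theta>\<^sub>1' s\<^sub>2' \<theta>\<^sub>2' = F1 \<gamma> s\<^sub>1 \<theta>\<^sub>1 s\<^sub>2 \<theta>\<^sub>2" "F2 \<gamma> s\<^sub>1' \<theta>\<^sub>1' s\<^sub>2' \<theta>\<^sub>2' = F2 \<gamma> s\<^sub>1 \<theta>\<^sub>1 s\<^sub>2 \<theta>\<^sub>2"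
    "chord_angle \<gamma> s\<^sub>1' s\<^sub>1' s\<^sub>2' \<theta>\<^sub>1' = chord_angle \<gamma> s\<^sub>1 s\<^sub>1 s\<^sub>2 \<theta>\<^sub>1"
    "chord_angle \<gamma> s\<^sub>2' s\<^sub>1' s\<^sub>2' \<theta>\<^sub>2' = chord_angle \<gamma> s\<^sub>2 s\<^sub>1 s\<^sub>2 \<theta>\<^sub>2"
proof -
  obtain k\<^sub>1 k\<^sub>2 l\<^sub>1 l\<^sub>2 :: int where k: "s\<^sub>1' = s\<^sub>1 + of_int k\<^sub>1 * T" "s\<^sub>2' = s\<^sub>2 + of_int k\<^sub>2 * T"
    "\<theta>\<^sub>1' = \<theta>\<^sub>1 + of_int l\<^sub>1 * (2 * pi)" "\<theta>\<^sub>2' = \<theta>\<^sub>2 + of_int l\<^sub>2 * (2 * pi)"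
    using assms(2-) proj_eq_iff_translate by metis
  have per: "\<gamma> (s + of_int k * T) = \<gamma> s" for s and k :: int
    using periodic_int_multiple[of \<gamma>, OF assms(1)] .
  note periods = per frame_periodic(3,4)[of \<gamma>, OF per]
  have "chord_normal \<gamma> (s + of_int k * T) s\<^sub>1' s\<^sub>2' = chord_normal \<gamma> s s\<^sub>1 s\<^sub>2"
    "chord_binormal \<gamma> (s + of_int k * T) s\<^sub>1' s\<^sub>2' = chord_binormal \<gamma> s s\<^sub>1 s\<^sub>2" for s and k :: int
    by (simp_all only: chord_normal_def chord_binormal_def k(1,2) periods)
  note chords = this[of s\<^sub>1 k\<^sub>1, folded k(1)] this[of s\<^sub>2 k\<^sub>2, folded k(2)]
  show "F1 \<gamma> s\<^sub>1' \<theta>\<^sub>1' s\<^sub>2' \<theta>\<^sub>2' = F1 \<gamma> s\<^sub>1 \<theta>\<^sub>1 s\<^sub>2 \<theta>\<^sub>2" "F2 \<gamma> s\<^sub>1' \<theta>\<^sub>1' s\<^sub>2' \<theta>\<^sub>2' = F2 \<gamma> s\<^sub>1 \<theta>\<^sub>1 s\<^sub>2 \<theta>\<^sub>2"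
    "chord_angle \<gamma> s\<^sub>1' s\<^sub>1' s\<^sub>2' \<theta>\<^sub>1' = chord_angle \<gamma> s\<^sub>1 s\<^sub>1 s\<^sub>2 \<theta>\<^sub>1"
    "chord_angle \<gamma> s\<^sub>2' s\<^sub>1' s\<^sub>2' \<theta>\<^sub>2' = chord_angle \<gamma> s\<^sub>2 s\<^sub>1 s\<^sub>2 \<theta>\<^sub>2"
    by (simp_all only: F_eq_chord chords chord_angle_def k(3,4)
          cos_sin_add_int_period angle_denom_offset_period)
qed

text \<open>If both coordinates vanish, the chord is a multiple of the velocity at \<open>s\<close>, so the tangent line at
  this end of the chord passes through the other end and the pair is special.\<close>

lemma chord_not_tangent:
  assumes "generic_knot T \<gamma>" "proj T s\<^sub>1 \<noteq> proj T s\<^sub>2" "(proj T s\<^sub>1, proj T s\<^sub>2) \<notin> special_pairs T \<gamma>"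
    and "s \<in> {s\<^sub>1, s\<^sub>2}"
  shows "chord_normal \<gamma> s s\<^sub>1 s\<^sub>2 \<noteq> 0 \<or> chord_binormal \<gamma> s s\<^sub>1 s\<^sub>2 \<noteq> 0"
proof (rule ccontr)
  assume neg: "\<not> ?thesis"
  have smooth: "smooth_on UNIV \<gamma>" and v: "\<And>s. norm (velocity \<gamma> s) = 1"
    and a: "acceleration \<gamma> s \<noteq> 0"
    using assms(1) by (auto simp: generic_knot_def knot_def velocity_def)
  let ?c = "(\<gamma> s\<^sub>2 - \<gamma> s\<^sub>1) \<bullet> velocity \<gamma> s"
  have chord: "\<gamma> s\<^sub>2 - \<gamma> s\<^sub>1 = ?c *\<^sub>R velocity \<gamma> s"
  proof (rule eq_tangential_component[OF v])
    show "normal \<gamma> s \<noteq> 0" using a by (simp add: normal_def)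
    show "velocity \<gamma> s \<bullet> normal \<gamma> s = 0"
      using velocity_perp_acceleration[OF smooth v] by (simp add: normal_def)
    show "(\<gamma> s\<^sub>2 - \<gamma> s\<^sub>1) \<bullet> normal \<gamma> s = 0"
      "(\<gamma> s\<^sub>2 - \<gamma> s\<^sub>1) \<bullet> cross3 (velocity \<gamma> s) (normal \<gamma> s) = 0"
      using neg by (auto simp: chord_normal_def chord_binormal_def binormal_def)
  qed
  have "\<gamma> s\<^sub>2 = \<gamma> s\<^sub>1 + ?c *\<^sub>R velocity \<gamma> s" "\<gamma> s\<^sub>1 = \<gamma> s\<^sub>2 + (- ?c) *\<^sub>R velocity \<gamma> s"
    using chord by (auto simp: algebra_simps)
  then have "\<gamma> s\<^sub>2 \<in> tangent_line \<gamma> s\<^sub>1 \<or> \<gamma> s\<^sub>1 \<in> tangent_line \<gamma> s\<^sub>2"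
    using assms(4) unfolding tangent_line_def by blast
  then show False using assms(2,3) unfolding special_pairs_def by blast
qed

lemma C_on_chord:
  assumes "smooth_on UNIV \<gamma>" "\<And>s. acceleration \<gamma> s \<noteq> 0" "open U"
    and "C_on n \<sigma> U" "C_on n \<sigma>\<^sub>1 U" "C_on n \<sigma>\<^sub>2 U"
  shows "C_on n (\<lambda>x. chord_normal \<gamma> (\<sigma> x) (\<sigma>\<^sub>1 x) (\<sigma>\<^sub>2 x)) U"
    and "C_on n (\<lambda>x. chord_binormal \<gamma> (\<sigma> x) (\<sigma>\<^sub>1 x) (\<sigma>\<^sub>2 x)) U"
proof -
  have comp: "C_on n (\<lambda>x. f (\<tau> x)) U" if "smooth_on UNIV f" "C_on n \<tau> U"
    for f :: "real \<Rightarrow> real^3" and \<tau>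
    using that unfolding smooth_on_def by (blast intro: C_on_compose[OF assms(3) subset_UNIV])
  note chord = C_on_diff[OF assms(3) comp[OF assms(1,6)] comp[OF assms(1,5)]]
  show "C_on n (\<lambda>x. chord_normal \<gamma> (\<sigma> x) (\<sigma>\<^sub>1 x) (\<sigma>\<^sub>2 x)) U"
    unfolding chord_normal_def
    by (rule C_on_inner[OF assms(3) chord comp[OF smooth_on_normal[OF assms(1,2)] assms(4)]])
  show "C_on n (\<lambda>x. chord_binormal \<gamma> (\<sigma> x) (\<sigma>\<^sub>1 x) (\<sigma>\<^sub>2 x)) U"
    unfolding chord_binormal_def
    by (rule C_on_inner[OF assms(3) chord comp[OF smooth_on_binormal[OF assms(1,2)] assms(4)]])
qed

lemma C_on_angle_offset:
  fixes a b \<theta> :: "'a::real_normed_vector \<Rightarrow> real"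
  assumes "open U" and ab: "C_on n a U" "C_on n b U" and \<theta>: "C_on n \<theta> U"
    and pos: "\<And>x. x \<in> U \<Longrightarrow> angle_denom (a x) (b x) (\<theta> x) > 0"
  shows "C_on n (\<lambda>x. angle_offset (a x) (b x) (\<theta> x)) U"
proof -
  note trig = C_on_sin_cos_arctan[OF assms(1)]
  note mult = C_on_mult[OF assms(1)] and add = C_on_add[OF assms(1)]
  have radius: "a x * a x + b x * b x > 0" if "x \<in> U" for x
  proof -
    have "a x \<noteq> 0 \<or> b x \<noteq> 0" using pos[OF that] by (auto simp: angle_denom_def)
    then show ?thesis
      using sum_power2_gt_zero_iff[of "a x" "b x"] by (simp add: power2_eq_square)
  qed
  have "C_on n (\<lambda>x. sqrt (a x * a x + b x * b x) + (a x * cos (\<theta> x) + b x * sin (\<theta> x))) U"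
    by (rule add[OF C_on_sqrt[OF assms(1) add[OF mult[OF ab(1) ab(1)] mult[OF ab(2) ab(2)]] radius]
          add[OF mult[OF ab(1) trig(2)[OF \<theta>]] mult[OF ab(2) trig(1)[OF \<theta>]]]])
  then have denom: "C_on n (\<lambda>x. angle_denom (a x) (b x) (\<theta> x)) U"
    by (simp add: angle_denom_def power2_eq_square)
  have "angle_denom (a x) (b x) (\<theta> x) \<noteq> 0" if "x \<in> U" for x using pos[OF that] by simp
  note inv = C_on_inverse[OF assms(1) denom this]
  have "C_on n (\<lambda>x. 2 * arctan ((a x * sin (\<theta> x) - b x * cos (\<theta> x))
      * inverse (angle_denom (a x) (b x) (\<theta> x)))) U"
    by (rule mult[OF C_on_const[OF assms(1)] trig(3)[OF mult[OF C_on_diff[OF assms(1)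
          mult[OF ab(1) trig(1)[OF \<theta>]] mult[OF ab(2) trig(2)[OF \<theta>]]] inv]]])
  then show ?thesis by (simp add: angle_offset_def divide_inverse)
qed

lemma C_on_chord_angle:
  assumes "smooth_on UNIV \<gamma>" "\<And>s. acceleration \<gamma> s \<noteq> 0" "open U"
    and "C_on n \<sigma> U" "C_on n \<sigma>\<^sub>1 U" "C_on n \<sigma>\<^sub>2 U" "C_on n \<theta> U"
    and "\<And>x. x \<in> U \<Longrightarrow> chord_denom \<gamma> (\<sigma> x) (\<sigma>\<^sub>1 x) (\<sigma>\<^sub>2 x) (\<theta> x) > 0"
  shows "C_on n (\<lambda>x. chord_angle \<gamma> (\<sigma> x) (\<sigma>\<^sub>1 x) (\<sigma>\<^sub>2 x) (\<theta> x)) U"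
  unfolding chord_angle_def
  by (rule C_on_angle_offset[OF assms(3) C_on_chord[OF assms(1-6)] assms(7)
        assms(8)[unfolded chord_denom_def]])

lemma open_chord_denom_pos:
  assumes "smooth_on UNIV \<gamma>" "\<And>s. acceleration \<gamma> s \<noteq> 0"
    and "C_on 0 \<sigma> UNIV" "C_on 0 \<sigma>\<^sub>1 UNIV" "C_on 0 \<sigma>\<^sub>2 UNIV" "C_on 0 \<theta> UNIV"
  shows "open {x. chord_denom \<gamma> (\<sigma> x) (\<sigma>\<^sub>1 x) (\<sigma>\<^sub>2 x) (\<theta> x) > 0}"
proof (rule open_Collect_less)
  note C_on_chord[OF assms(1,2) open_UNIV assms(3-5)]
  then show "continuous_on UNIV (\<lambda>x. chord_denom \<gamma> (\<sigma> x) (\<sigma>\<^sub>1 x) (\<sigma>\<^sub>2 x) (\<theta> x))"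
    using assms(6) unfolding chord_denom_def angle_denom_def C_on.simps
    by (intro continuous_intros)
qed simp

section \<open>The manifold off the diagonal\<close>

lemma C_on_coordinates:
  fixes U :: "((real \<times> real) \<times> (real \<times> real)) set"
  assumes "open U"
  shows "C_on n (\<lambda>x. fst (fst x)) U" "C_on n (\<lambda>x. snd (fst x)) U"
    "C_on n (\<lambda>x. fst (snd x)) U" "C_on n (\<lambda>x. snd (snd x)) U"
  by (rule C_on_fst[OF assms] C_on_snd[OF assms] C_on_id[OF assms])+

lemma open_map_proj_torus4: "open_map euclidean (torus4_topology T) (proj_torus4 T)"
  unfolding torus4_topology_def proj_torus4_def
  by (intro open_map_map_prod open_map_proj)

text \<open>A point with \<open>F\<^sub>1 < 0\<close> or \<open>F\<^sub>2 < 0\<close> has a neighbourhood upstairs where this persists, and by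
  periodicity no point of its image has other representatives at which both functions are nonnegative.\<close>

lemma proj_torus4_mem_M0_iff:
  assumes "generic_knot T \<gamma>" "proj T s\<^sub>1 \<noteq> proj T s\<^sub>2"
  shows "proj_torus4 T ((s\<^sub>1, \<theta>\<^sub>1), (s\<^sub>2, \<theta>\<^sub>2)) \<in> M0 T \<gamma> \<longleftrightarrow>
    F1 \<gamma> s\<^sub>1 \<theta>\<^sub>1 s\<^sub>2 \<theta>\<^sub>2 \<ge> 0 \<and> F2 \<gamma> s\<^sub>1 \<theta>\<^sub>1 s\<^sub>2 \<theta>\<^sub>2 \<ge> 0"
proof -
  have smooth: "smooth_on UNIV \<gamma>" and a: "\<And>s. acceleration \<gamma> s \<noteq> 0" and per: "\<And>s. \<gamma> (s + T) = \<gamma> s"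
    using assms(1) by (auto simp: generic_knot_def knot_def)
  define E where "E = {((proj T s\<^sub>1, proj (2 * pi) \<theta>\<^sub>1), (proj T s\<^sub>2, proj (2 * pi) \<theta>\<^sub>2)) | s\<^sub>1 \<theta>\<^sub>1 s\<^sub>2 \<theta>\<^sub>2.
        F1 \<gamma> s\<^sub>1 \<theta>\<^sub>1 s\<^sub>2 \<theta>\<^sub>2 \<ge> 0 \<and> F2 \<gamma> s\<^sub>1 \<theta>\<^sub>1 s\<^sub>2 \<theta>\<^sub>2 \<ge> 0 \<and> proj T s\<^sub>1 \<noteq> proj T s\<^sub>2}"
  have M0: "M0 T \<gamma> = torus4_topology T closure_of E" by (simp add: M0_def E_def)
  let ?F = "\<lambda>x. case x of ((s\<^sub>1, \<theta>\<^sub>1), (s\<^sub>2, \<theta>\<^sub>2)) \<Rightarrow> min (F1 \<gamma> s\<^sub>1 \<theta>\<^sub>1 s\<^sub>2 \<theta>\<^sub>2) (F2 \<gamma> s\<^sub>1 \<theta>\<^sub>1 s\<^sub>2 \<theta>\<^sub>2)"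
  have E: "?F y \<ge> 0" if y_E: "proj_torus4 T y \<in> E" for y
  proof -
    obtain t\<^sub>1 \<phi>\<^sub>1 t\<^sub>2 \<phi>\<^sub>2 where y: "y = ((t\<^sub>1, \<phi>\<^sub>1), (t\<^sub>2, \<phi>\<^sub>2))" by (metis prod.exhaust)
    then obtain s\<^sub>1 \<theta>\<^sub>1 s\<^sub>2 \<theta>\<^sub>2 where "proj T s\<^sub>1 = proj T t\<^sub>1" "proj (2 * pi) \<theta>\<^sub>1 = proj (2 * pi) \<phi>\<^sub>1"
      "proj T s\<^sub>2 = proj T t\<^sub>2" "proj (2 * pi) \<theta>\<^sub>2 = proj (2 * pi) \<phi>\<^sub>2"
      "F1 \<gamma> s\<^sub>1 \<theta>\<^sub>1 s\<^sub>2 \<theta>\<^sub>2 \<ge> 0" "F2 \<gamma> s\<^sub>1 \<theta>\<^sub>1 s\<^sub>2 \<theta>\<^sub>2 \<ge> 0"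
      using y_E unfolding E_def proj_torus4_def by clarsimp
    with F_periodic[of \<gamma>, OF per, of s\<^sub>1 t\<^sub>1 s\<^sub>2 t\<^sub>2 \<theta>\<^sub>1 \<phi>\<^sub>1 \<theta>\<^sub>2 \<phi>\<^sub>2] show ?thesis by (simp add: y)
  qed
  have cont: "continuous_on UNIV ?F"
  proof -
    note c = C_on_coordinates[OF open_UNIV, of 0]
    show ?thesis
      using C_on_chord[OF smooth a open_UNIV c(1) c(1) c(3)]
        C_on_chord[OF smooth a open_UNIV c(3) c(1) c(3)] c(2,4)
      unfolding case_prod_unfold F_eq_chord C_on.simps
      by (intro continuous_intros)
  qed
  show ?thesis
  proof
    have "proj_torus4 T x \<notin> M0 T \<gamma>" if x: "?F x < 0" for x
      unfolding M0
    proof (rule not_in_closure_of_open_map[OF open_map_proj_torus4])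
      show "open {x. ?F x < 0}" by (rule open_Collect_less[OF cont continuous_on_const])
      show "x \<in> {x. ?F x < 0}" using x by simp
      show "proj_torus4 T y \<notin> E" if "y \<in> {x. ?F x < 0}" for y
        using E[of y] that by (auto simp del: split_paired_All)
    qed
    moreover assume "proj_torus4 T ((s\<^sub>1, \<theta>\<^sub>1), (s\<^sub>2, \<theta>\<^sub>2)) \<in> M0 T \<gamma>"
    ultimately have "\<not> ?F ((s\<^sub>1, \<theta>\<^sub>1), (s\<^sub>2, \<theta>\<^sub>2)) < 0" by blast
    then show "F1 \<gamma> s\<^sub>1 \<theta>\<^sub>1 s\<^sub>2 \<theta>\<^sub>2 \<ge> 0 \<and> F2 \<gamma> s\<^sub>1 \<theta>\<^sub>1 s\<^sub>2 \<theta>\<^sub>2 \<ge> 0" by (simp add: not_less)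
  next
    assume "F1 \<gamma> s\<^sub>1 \<theta>\<^sub>1 s\<^sub>2 \<theta>\<^sub>2 \<ge> 0 \<and> F2 \<gamma> s\<^sub>1 \<theta>\<^sub>1 s\<^sub>2 \<theta>\<^sub>2 \<ge> 0"
    then have "proj_torus4 T ((s\<^sub>1, \<theta>\<^sub>1), (s\<^sub>2, \<theta>\<^sub>2)) \<in> E"
      unfolding E_def proj_torus4_def using assms(2) by simp blast
    moreover have "E \<subseteq> topspace (torus4_topology T)"
      by (auto simp: E_def torus4_topology_def topspace_circle circle_eq)
    ultimately show "proj_torus4 T ((s\<^sub>1, \<theta>\<^sub>1), (s\<^sub>2, \<theta>\<^sub>2)) \<in> M0 T \<gamma>"
      unfolding M0 using closure_of_subset by blast
  qed
qed

section \<open>The trivialization and its local inverses\<close>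

text \<open>The diffeomorphism, lifted to the covering spaces.\<close>

definition trivialization ::
  "(real \<Rightarrow> real^3) \<Rightarrow> (real \<times> real) \<times> (real \<times> real) \<Rightarrow> (real \<times> real) \<times> (real \<times> real)" where
  "trivialization \<gamma> = (\<lambda>((s\<^sub>1, \<theta>\<^sub>1), (s\<^sub>2, \<theta>\<^sub>2)).
     ((s\<^sub>1, s\<^sub>2), (chord_angle \<gamma> s\<^sub>1 s\<^sub>1 s\<^sub>2 \<theta>\<^sub>1, chord_angle \<gamma> s\<^sub>2 s\<^sub>1 s\<^sub>2 \<theta>\<^sub>2)))"

text \<open>A local lift of the inverse. The parameters \<open>\<phi>\<^sub>1\<close> and \<open>\<phi>\<^sub>2\<close> are reference angles: the map is
  smooth near the pairs \<open>(s\<^sub>1, s\<^sub>2)\<close> at which neither of them is opposite to the projected chord.\<close>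

definition section_from ::
  "(real \<Rightarrow> real^3) \<Rightarrow> real \<Rightarrow> real \<Rightarrow> (real \<times> real) \<times> (real \<times> real) \<Rightarrow> (real \<times> real) \<times> (real \<times> real)" where
  "section_from \<gamma> \<phi>\<^sub>1 \<phi>\<^sub>2 = (\<lambda>((s\<^sub>1, s\<^sub>2), (t\<^sub>1, t\<^sub>2)).
     ((s\<^sub>1, \<phi>\<^sub>1 - chord_angle \<gamma> s\<^sub>1 s\<^sub>1 s\<^sub>2 \<phi>\<^sub>1 + t\<^sub>1), (s\<^sub>2, \<phi>\<^sub>2 - chord_angle \<gamma> s\<^sub>2 s\<^sub>1 s\<^sub>2 \<phi>\<^sub>2 + t\<^sub>2)))"

lemma smooth_on_trivialization:
  assumes "smooth_on UNIV \<gamma>" "\<And>s. acceleration \<gamma> s \<noteq> 0"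
  defines "U \<equiv> {x. chord_denom \<gamma> (fst (fst x)) (fst (fst x)) (fst (snd x)) (snd (fst x)) > 0} \<inter>
    {x. chord_denom \<gamma> (fst (snd x)) (fst (fst x)) (fst (snd x)) (snd (snd x)) > 0}"
  shows "open U" "smooth_on U (trivialization \<gamma>)"
proof -
  note c0 = C_on_coordinates[OF open_UNIV, of 0]
  show U: "open U"
    unfolding U_def
    by (rule open_Int[OF open_chord_denom_pos[OF assms(1,2) c0(1) c0(1) c0(3) c0(2)]
          open_chord_denom_pos[OF assms(1,2) c0(3) c0(1) c0(3) c0(4)]])
  show "smooth_on U (trivialization \<gamma>)"
    unfolding smooth_on_def trivialization_def case_prod_unfold
  proof
    fix n
    note c = C_on_coordinates[OF U, of n] and pair = C_on_Pair[OF U]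
    show "C_on n (\<lambda>x. ((fst (fst x), fst (snd x)),
        (chord_angle \<gamma> (fst (fst x)) (fst (fst x)) (fst (snd x)) (snd (fst x)),
         chord_angle \<gamma> (fst (snd x)) (fst (fst x)) (fst (snd x)) (snd (snd x))))) U"
      by (rule pair[OF pair[OF c(1,3)] pair[OF
            C_on_chord_angle[OF assms(1,2) U c(1) c(1) c(3) c(2)]
            C_on_chord_angle[OF assms(1,2) U c(3) c(1) c(3) c(4)]]])
         (auto simp: U_def)
  qed
qed

lemma smooth_on_section_from:
  assumes "smooth_on UNIV \<gamma>" "\<And>s. acceleration \<gamma> s \<noteq> 0"
  defines "V \<equiv> \<lambda>\<phi>\<^sub>1 \<phi>\<^sub>2. {y. chord_denom \<gamma> (fst (fst y)) (fst (fst y)) (snd (fst y)) \<phi>\<^sub>1 > 0} \<inter>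
    {y. chord_denom \<gamma> (snd (fst y)) (fst (fst y)) (snd (fst y)) \<phi>\<^sub>2 > 0}"
  shows "open (V \<phi>\<^sub>1 \<phi>\<^sub>2 :: ((real \<times> real) \<times> (real \<times> real)) set)" "smooth_on (V \<phi>\<^sub>1 \<phi>\<^sub>2) (section_from \<gamma> \<phi>\<^sub>1 \<phi>\<^sub>2)"
proof -
  note c0 = C_on_coordinates[OF open_UNIV, of 0] and k0 = C_on_const[OF open_UNIV, of 0]
  show V: "open (V \<phi>\<^sub>1 \<phi>\<^sub>2 :: ((real \<times> real) \<times> (real \<times> real)) set)"
    unfolding V_def
    by (rule open_Int[OF open_chord_denom_pos[OF assms(1,2) c0(1) c0(1) c0(2) k0]
          open_chord_denom_pos[OF assms(1,2) c0(2) c0(1) c0(2) k0]])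
  show "smooth_on (V \<phi>\<^sub>1 \<phi>\<^sub>2) (section_from \<gamma> \<phi>\<^sub>1 \<phi>\<^sub>2)"
    unfolding smooth_on_def section_from_def case_prod_unfold
  proof
    fix n
    note c = C_on_coordinates[OF V, of n] and k = C_on_const[OF V, of n]
      and pair = C_on_Pair[OF V] and add = C_on_add[OF V] and diff = C_on_diff[OF V]
    show "C_on n (\<lambda>y.
        ((fst (fst y), \<phi>\<^sub>1 - chord_angle \<gamma> (fst (fst y)) (fst (fst y)) (snd (fst y)) \<phi>\<^sub>1 + fst (snd y)),
         (snd (fst y), \<phi>\<^sub>2 - chord_angle \<gamma> (snd (fst y)) (fst (fst y)) (snd (fst y)) \<phi>\<^sub>2 + snd (snd y))))
        (V \<phi>\<^sub>1 \<phi>\<^sub>2)"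
      by (rule pair[OF
            pair[OF c(1) add[OF diff[OF k C_on_chord_angle[OF assms(1,2) V c(1) c(1) c(2) k]] c(3)]]
            pair[OF c(2) add[OF diff[OF k C_on_chord_angle[OF assms(1,2) V c(2) c(1) c(2) k]] c(4)]]])
         (auto simp: V_def)
  qed
qed

theorem lemma58:
  fixes \<gamma> :: "real \<Rightarrow> real^3" and T \<delta> :: real
  assumes "generic_knot T \<gamma>"
    and "admissible T \<gamma> \<delta>"
  shows "diffeomorphic (proj_torus4 T) (proj_torus2 T)
           (M0_over T \<gamma> (closed_standard_set T \<gamma> \<delta>))
           (closed_standard_set T \<gamma> \<delta> \<times> ({-pi/2..pi/2} \<times> {-pi/2..pi/2}))"
proof -
  let ?S = "closed_standard_set T \<gamma> \<delta>"
  let ?A = "M0_over T \<gamma> ?S" and ?B = "?S \<times> ({-pi/2..pi/2} \<times> {-pi/2..pi/2})"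
  have smooth: "smooth_on UNIV \<gamma>" and a: "\<And>s. acceleration \<gamma> s \<noteq> 0" and per: "\<And>s. \<gamma> (s + T) = \<gamma> s"
    using assms(1) by (auto simp: generic_knot_def knot_def)
  have \<delta>: "\<delta> > 0" using assms(2) by (simp add: admissible_def)
  have chord: "chord_normal \<gamma> s s\<^sub>1 s\<^sub>2 \<noteq> 0 \<or> chord_binormal \<gamma> s s\<^sub>1 s\<^sub>2 \<noteq> 0"
    if "(proj T s\<^sub>1, proj T s\<^sub>2) \<in> ?S" "s \<in> {s\<^sub>1, s\<^sub>2}" for s s\<^sub>1 s\<^sub>2
    using chord_not_tangent[OF assms(1) _ _ that(2)] that(1)
      closed_standard_set_not_diagonal[OF \<delta>] closed_standard_set_not_special[OF \<delta>] by blast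
  have A: "proj_torus4 T ((s\<^sub>1, \<theta>\<^sub>1), (s\<^sub>2, \<theta>\<^sub>2)) \<in> ?A \<longleftrightarrow> (proj T s\<^sub>1, proj T s\<^sub>2) \<in> ?S \<and>
      F1 \<gamma> s\<^sub>1 \<theta>\<^sub>1 s\<^sub>2 \<theta>\<^sub>2 \<ge> 0 \<and> F2 \<gamma> s\<^sub>1 \<theta>\<^sub>1 s\<^sub>2 \<theta>\<^sub>2 \<ge> 0" for s\<^sub>1 \<theta>\<^sub>1 s\<^sub>2 \<theta>\<^sub>2
  proof -
    have "proj_torus4 T ((s\<^sub>1, \<theta>\<^sub>1), (s\<^sub>2, \<theta>\<^sub>2)) \<in> ?A \<longleftrightarrow>
        (proj T s\<^sub>1, proj T s\<^sub>2) \<in> ?S \<and> proj_torus4 T ((s\<^sub>1, \<theta>\<^sub>1), (s\<^sub>2, \<theta>\<^sub>2)) \<in> M0 T \<gamma>"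
      by (auto simp: M0_over_def proj_torus4_def)
    then show ?thesis
      using proj_torus4_mem_M0_iff[OF assms(1), of s\<^sub>1 s\<^sub>2 \<theta>\<^sub>1 \<theta>\<^sub>2]
        closed_standard_set_not_diagonal[OF \<delta>, of T s\<^sub>1 s\<^sub>2 \<gamma>] by blast
  qed
  have B: "proj_torus2 T ((s\<^sub>1, s\<^sub>2), (t\<^sub>1, t\<^sub>2)) \<in> ?B \<longleftrightarrow>
      (proj T s\<^sub>1, proj T s\<^sub>2) \<in> ?S \<and> \<bar>t\<^sub>1\<bar> \<le> pi / 2 \<and> \<bar>t\<^sub>2\<bar> \<le> pi / 2" for s\<^sub>1 s\<^sub>2 t\<^sub>1 t\<^sub>2
    by (auto simp: proj_torus2_def)
  have angle: "chord_denom \<gamma> s\<^sub>1 s\<^sub>1 s\<^sub>2 \<theta>\<^sub>1 > 0" "\<bar>chord_angle \<gamma> s\<^sub>1 s\<^sub>1 s\<^sub>2 \<theta>\<^sub>1\<bar> \<le> pi / 2"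
      "chord_denom \<gamma> s\<^sub>2 s\<^sub>1 s\<^sub>2 \<theta>\<^sub>2 > 0" "\<bar>chord_angle \<gamma> s\<^sub>2 s\<^sub>1 s\<^sub>2 \<theta>\<^sub>2\<bar> \<le> pi / 2"
    if "proj_torus4 T ((s\<^sub>1, \<theta>\<^sub>1), (s\<^sub>2, \<theta>\<^sub>2)) \<in> ?A" for s\<^sub>1 \<theta>\<^sub>1 s\<^sub>2 \<theta>\<^sub>2
    using that angle_offset_le_pi_half[OF chord[of s\<^sub>1 s\<^sub>2 s\<^sub>1], of \<theta>\<^sub>1]
      angle_offset_le_pi_half[OF chord[of s\<^sub>1 s\<^sub>2 s\<^sub>2], of \<theta>\<^sub>2]
    unfolding A F_eq_chord chord_denom_def chord_angle_def by auto
  show ?thesis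
  proof (rule diffeomorphic_if_lifts[where h = "trivialization \<gamma>"])
    show "?A \<subseteq> range (proj_torus4 T)"
    proof
      fix X assume X: "X \<in> ?A"
      have "topspace (torus4_topology T) = range (proj_torus4 T)"
        by (auto simp: torus4_topology_def topspace_circle circle_eq proj_torus4_def image_iff)
      then show "X \<in> range (proj_torus4 T)"
        using X closure_of_subset_topspace unfolding M0_over_def M0_def by fastforce
    qed
    show "?B \<subseteq> range (proj_torus2 T)"
    proof clarify
      fix P\<^sub>1 P\<^sub>2 :: "real set" and t\<^sub>1 t\<^sub>2 :: real
      assume "(P\<^sub>1, P\<^sub>2) \<in> ?S"
      then obtain s\<^sub>1 s\<^sub>2 where "(P\<^sub>1, P\<^sub>2) = (proj T s\<^sub>1, proj T s\<^sub>2)"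
        by (rule closed_standard_set_lift)
      then show "((P\<^sub>1, P\<^sub>2), (t\<^sub>1, t\<^sub>2)) \<in> range (proj_torus2 T)"
        by (intro range_eqI[of _ _ "((s\<^sub>1, s\<^sub>2), (t\<^sub>1, t\<^sub>2))"]) (simp add: proj_torus2_def)
    qed
    show "proj_torus2 T (trivialization \<gamma> x) = proj_torus2 T (trivialization \<gamma> y)"
      if "proj_torus4 T x = proj_torus4 T y" for x y
    proof -
      obtain s\<^sub>1 \<theta>\<^sub>1 s\<^sub>2 \<theta>\<^sub>2 s\<^sub>1' \<theta>\<^sub>1' s\<^sub>2' \<theta>\<^sub>2' where
        xy: "x = ((s\<^sub>1, \<theta>\<^sub>1), (s\<^sub>2, \<theta>\<^sub>2))" "y = ((s\<^sub>1', \<theta>\<^sub>1'), (s\<^sub>2', \<theta>\<^sub>2'))" by (metis prod.exhaust)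
      show ?thesis
        using that F_periodic(3,4)[of \<gamma>, OF per, of s\<^sub>1' s\<^sub>1 s\<^sub>2' s\<^sub>2 \<theta>\<^sub>1' \<theta>\<^sub>1 \<theta>\<^sub>2' \<theta>\<^sub>2]
        by (simp add: xy proj_torus4_def proj_torus2_def trivialization_def)
    qed
    show "proj_torus2 T (trivialization \<gamma> x) \<in> ?B" if "proj_torus4 T x \<in> ?A" for x
    proof -
      obtain s\<^sub>1 \<theta>\<^sub>1 s\<^sub>2 \<theta>\<^sub>2 where x: "x = ((s\<^sub>1, \<theta>\<^sub>1), (s\<^sub>2, \<theta>\<^sub>2))" by (metis prod.exhaust)
      show ?thesis
        using that[unfolded x] angle(2,4)[OF that[unfolded x]]
        unfolding x trivialization_def prod.case A B by blast
    qed
    show "\<exists>U. open U \<and> x \<in> U \<and> smooth_on U (trivialization \<gamma>)" if "proj_torus4 T x \<in> ?A" for x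
    proof -
      obtain s\<^sub>1 \<theta>\<^sub>1 s\<^sub>2 \<theta>\<^sub>2 where x: "x = ((s\<^sub>1, \<theta>\<^sub>1), (s\<^sub>2, \<theta>\<^sub>2))" by (metis prod.exhaust)
      show ?thesis
        using smooth_on_trivialization[of \<gamma>, OF smooth a] angle(1,3)[OF that[unfolded x]]
        by (intro exI conjI) (auto simp: x)
    qed
    show "proj_torus4 T x = proj_torus4 T y"
      if "proj_torus4 T x \<in> ?A" "proj_torus4 T y \<in> ?A"
        and eq: "proj_torus2 T (trivialization \<gamma> x) = proj_torus2 T (trivialization \<gamma> y)" for x y
    proof -
      obtain s\<^sub>1 \<theta>\<^sub>1 s\<^sub>2 \<theta>\<^sub>2 s\<^sub>1' \<theta>\<^sub>1' s\<^sub>2' \<theta>\<^sub>2' where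
        xy: "x = ((s\<^sub>1, \<theta>\<^sub>1), (s\<^sub>2, \<theta>\<^sub>2))" "y = ((s\<^sub>1', \<theta>\<^sub>1'), (s\<^sub>2', \<theta>\<^sub>2'))" by (metis prod.exhaust)
      have s: "proj T s\<^sub>1' = proj T s\<^sub>1" "proj T s\<^sub>2' = proj T s\<^sub>2"
        using eq by (simp_all add: xy proj_torus2_def trivialization_def)
      then have y: "proj_torus4 T y = proj_torus4 T ((s\<^sub>1, \<theta>\<^sub>1'), (s\<^sub>2, \<theta>\<^sub>2'))"
        by (simp add: xy proj_torus4_def)
      have "chord_angle \<gamma> s\<^sub>1 s\<^sub>1 s\<^sub>2 \<theta>\<^sub>1' = chord_angle \<gamma> s\<^sub>1 s\<^sub>1 s\<^sub>2 \<theta>\<^sub>1"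
        "chord_angle \<gamma> s\<^sub>2 s\<^sub>1 s\<^sub>2 \<theta>\<^sub>2' = chord_angle \<gamma> s\<^sub>2 s\<^sub>1 s\<^sub>2 \<theta>\<^sub>2"
        using eq F_periodic(3,4)[of \<gamma>, OF per s refl refl]
        by (simp_all add: xy proj_torus2_def trivialization_def)
      then have "proj (2 * pi) \<theta>\<^sub>1' = proj (2 * pi) \<theta>\<^sub>1" "proj (2 * pi) \<theta>\<^sub>2' = proj (2 * pi) \<theta>\<^sub>2"
        using angle(1,3)[OF that(1)[unfolded xy]] angle(1,3)[OF that(2)[unfolded y]]
          angle_offset_inj
        unfolding chord_denom_def chord_angle_def by blast+
      then show ?thesis unfolding y by (simp add: xy proj_torus4_def)
    qed
    show "\<exists>V G. open V \<and> y \<in> V \<and> smooth_on V G \<and> (\<forall>z\<in>V. proj_torus2 T z \<in> ?B \<longrightarrow>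
        proj_torus4 T (G z) \<in> ?A \<and> proj_torus2 T (trivialization \<gamma> (G z)) = proj_torus2 T z)"
      if "proj_torus2 T y \<in> ?B" for y
    proof -
      obtain s\<^sub>1 s\<^sub>2 t\<^sub>1 t\<^sub>2 where y: "y = ((s\<^sub>1, s\<^sub>2), (t\<^sub>1, t\<^sub>2))" by (metis prod.exhaust)
      have S: "(proj T s\<^sub>1, proj T s\<^sub>2) \<in> ?S" using that unfolding y B by blast
      \<comment> \<open>The direction of the projected chord itself serves as reference angle.\<close>
      have ex: "\<exists>\<phi>. chord_denom \<gamma> s s\<^sub>1 s\<^sub>2 \<phi> > 0" if s: "s \<in> {s\<^sub>1, s\<^sub>2}" for s
      proof -
        obtain r \<phi> where r: "r > 0" "chord_normal \<gamma> s s\<^sub>1 s\<^sub>2 = r * cos \<phi>" "chord_binormal \<gamma> s s\<^sub>1 s\<^sub>2 = r * sin \<phi>"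
          using polar_coordinates[OF chord[OF S s]] .
        have "chord_denom \<gamma> s s\<^sub>1 s\<^sub>2 \<phi> = r + r"
          unfolding chord_denom_def r(2,3) angle_denom_def polar_radius[OF r(1)] polar_projection by simp
        then show ?thesis using r(1) by (intro exI[of _ \<phi>]) simp
      qed
      obtain \<phi>\<^sub>1 \<phi>\<^sub>2 where \<phi>: "chord_denom \<gamma> s\<^sub>1 s\<^sub>1 s\<^sub>2 \<phi>\<^sub>1 > 0" "chord_denom \<gamma> s\<^sub>2 s\<^sub>1 s\<^sub>2 \<phi>\<^sub>2 > 0"
        using ex[of s\<^sub>1] ex[of s\<^sub>2] by auto
      show ?thesis
      proof (intro exI conjI ballI impI)
        show "open ({y :: (real \<times> real) \<times> (real \<times> real).
              chord_denom \<gamma> (fst (fst y)) (fst (fst y)) (snd (fst y)) \<phi>\<^sub>1 > 0} \<inter>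
            {y. chord_denom \<gamma> (snd (fst y)) (fst (fst y)) (snd (fst y)) \<phi>\<^sub>2 > 0})" (is "open ?V")
          by (rule smooth_on_section_from(1)[of \<gamma>, OF smooth a])
        show "y \<in> ?V" using \<phi> by (simp add: y)
        show "smooth_on ?V (section_from \<gamma> \<phi>\<^sub>1 \<phi>\<^sub>2)"
          by (rule smooth_on_section_from(2)[of \<gamma>, OF smooth a])
        fix z assume z: "z \<in> ?V" "proj_torus2 T z \<in> ?B"
        obtain s\<^sub>1' s\<^sub>2' t\<^sub>1' t\<^sub>2' where z': "z = ((s\<^sub>1', s\<^sub>2'), (t\<^sub>1', t\<^sub>2'))" by (metis prod.exhaust)
        have t: "(proj T s\<^sub>1', proj T s\<^sub>2') \<in> ?S" "\<bar>t\<^sub>1'\<bar> \<le> pi / 2" "\<bar>t\<^sub>2'\<bar> \<le> pi / 2"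
          using z(2) unfolding z' B by blast+
        have d: "angle_denom (chord_normal \<gamma> s\<^sub>1' s\<^sub>1' s\<^sub>2') (chord_binormal \<gamma> s\<^sub>1' s\<^sub>1' s\<^sub>2') \<phi>\<^sub>1 > 0"
          "angle_denom (chord_normal \<gamma> s\<^sub>2' s\<^sub>1' s\<^sub>2') (chord_binormal \<gamma> s\<^sub>2' s\<^sub>1' s\<^sub>2') \<phi>\<^sub>2 > 0"
          using z(1) by (simp_all add: z' chord_denom_def)
        note lift = angle_offset_prescribed[OF d(1) t(2)] angle_offset_prescribed[OF d(2) t(3)]
        show "proj_torus4 T (section_from \<gamma> \<phi>\<^sub>1 \<phi>\<^sub>2 z) \<in> ?A"
          unfolding z' section_from_def prod.case A F_eq_chord chord_angle_def
          using t(1) lift(2,4) by blast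
        show "proj_torus2 T (trivialization \<gamma> (section_from \<gamma> \<phi>\<^sub>1 \<phi>\<^sub>2 z)) = proj_torus2 T z"
          unfolding z' section_from_def trivialization_def prod.case chord_angle_def lift(1,3) ..
      qed
    qed
  qed
qed

end
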